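(* Suppose that: (i) there are positive constants $A,M$ independent of $N$ with $\frac1N\sum_{j=1}^N m_j=M$ and $\max_j|m_j|\le A$; (ii) the functions $b,K_{ij}$ are $C^4$ and the derivatives of $b$ and $K_{ij}$ up to order $4$ are uniformly bounded (uniformly in $i,j$). Then the Random Batch Method converges weakly with first order for the empirical measure $\mu^N=\frac1N\sum_{j=1}^N\omega_j\,\delta(x-X^j)$, where $\omega_j=\frac{Nm_j}{\sum_{l}m_l}$. In particular, let $X$ be the solution of the full interacting particle system and $\tilde X$ the Random Batch Method process with time step $\tau$, and for a test function $\varphi\in C_b^\infty(\mathbb{R}^d)$ define the weak error $$E_k:=\left|\frac1N\sum_{i=1}^N\omega_i\,\mathbb{E}\varphi(\tilde X^i(k\tau))-\frac1N\sum_{i=1}^N\omega_i\,\mathbb{E}\varphi(X^i(k\tau))\right|.$$ Then $$\sup_{k:\,k\tau\le T}|E_k|\le C\tau,$$ where $C=C(\varphi,T)$ is independent of $N$ and $\tau$, but depends on $\varphi$.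
   Context: Fix $d\ge1$, $T>0$, $\sigma\in\mathbb{R}$, a vector field $b:\mathbb{R}^d\to\mathbb{R}^d$, weights $m_j\ge0$ and kernels $K_{ij}:\mathbb{R}^d\times\mathbb{R}^d\to\mathbb{R}^d$, $1\le i,j\le N$. $C_b^\infty(\mathbb{R}^d)$ is the set of smooth real functions that are bounded together with all their derivatives. Full system: $X=(X^1,\dots,X^N)$ solves on $[0,T]$ $$dX^i=b(X^i)\,dt+\frac{1}{N-1}\sum_{j\ne i}m_jK_{ij}(X^i,X^j)\,dt+\sigma\,dW^i,\qquad X^i(0)=X_0^i,$$ with $W^1,\dots,W^N$ independent standard $d$-dimensional Brownian motions. Random Batch Method (RBM): let $N=np$ with batch size $p\ge2$, time step $\tau>0$, $t_k=k\tau$. At each $t_{k-1}$ ($k\ge1$), the index set $\{1,\dots,N\}$ is divided uniformly at random into $n$ batches of size $p$; this division is denoted $\mathcal{C}^{(k-1)}$. For $t\in[t_{k-1},t_k)$, the (time-continuous) process $\tilde X$ solves, for each batch $\mathcal{C}_q$ of $\mathcal{C}^{(k-1)}$ and each $i\in\mathcal{C}_q$, $$d\tilde X^i=b(\tilde X^i)\,dt+\frac{1}{p-1}\sum_{j\in\mathcal{C}_q,\,j\ne i}m_jK_{ij}(\tilde X^i,\tilde X^j)\,dt+\sigma\,dW^i,$$ with the same initial values $\tilde X^i(0)=X_0^i$ and the same Brownian motions as the full system. The random variables $X_0^i$, $W^i$ ($1\le i\le N$), $\mathcal{C}^{(k)}$ ($k\ge0$) are defined on a common probability space and are all independent. $\mathbb{E}$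 denotes expectation on this space. *)

theory Defs
  imports "HOL-Probability.Probability" "HOL-Library.Disjoint_Sets"
begin

section \<open>Smoothness classes\<close>

text \<open>The iterated partial derivative along a list of vectors. The order of a derivative is the
  length of the list; the empty list gives the function itself.\<close>

primrec partials ::
  "'a list \<Rightarrow> ('a::euclidean_space \<Rightarrow> 'b::euclidean_space) \<Rightarrow> 'a \<Rightarrow> 'b" where
  "partials [] f = f"
| "partials (v # vs) f = (\<lambda>x. frechet_derivative (partials vs f) (at x) v)"

text \<open>Differentiability is demanded because \<^const>\<open>frechet_derivative\<close> is unspecified at points
  where the function is not differentiable.\<close>

definition Ck :: "nat \<Rightarrow> ('a::euclidean_space \<Rightarrow> 'b::euclidean_space) \<Rightarrow> bool" where
  "Ck k f \<longleftrightarrow>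
     (\<forall>vs. set vs \<subseteq> Basis \<and> length vs < k \<longrightarrow> (\<forall>x. partials vs f differentiable at x)) \<and>
     (\<forall>vs. set vs \<subseteq> Basis \<and> length vs \<le> k \<longrightarrow> continuous_on UNIV (partials vs f))"

text \<open>The orders are explicit because the two coefficients need different ones. First-order
  convergence uniform in the initial data fails for Lipschitz but unbounded kernels such as
  \<open>K(x, y) = y - x\<close>, so order \<open>0\<close> has to be included for the kernels; the vector field \<open>b\<close> may
  grow linearly.\<close>

definition derivs_bounded_by ::
  "nat set \<Rightarrow> real \<Rightarrow> ('a::euclidean_space \<Rightarrow> 'b::euclidean_space) \<Rightarrow> bool" where
  "derivs_bounded_by orders L f \<longleftrightarrow>
     (\<forall>vs. set vs \<subseteq> Basis \<and> length vs \<in> orders \<longrightarrow> (\<forall>x. norm (partials vs f x) \<le> L))"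

definition Cb_inf :: "('a::euclidean_space \<Rightarrow> real) set" where
  "Cb_inf = {f. (\<forall>k. Ck k f) \<and> (\<forall>vs. set vs \<subseteq> Basis \<longrightarrow> bounded (range (partials vs f)))}"


section \<open>Driving randomness\<close>

definition standard_brownian_motion ::
  "'w measure \<Rightarrow> (real \<Rightarrow> 'w \<Rightarrow> real ^ 'd) \<Rightarrow> bool" where
  "standard_brownian_motion P W \<longleftrightarrow>
     (\<forall>t\<ge>0. W t \<in> borel_measurable P) \<and>
     (AE \<omega> in P. W 0 \<omega> = 0) \<and>
     (AE \<omega> in P. continuous_on {0..} (\<lambda>t. W t \<omega>)) \<and>
     (\<forall>s t. 0 \<le> s \<and> s < t \<longrightarrow>
        distributed P lborel (\<lambda>\<omega>. W t \<omega> - W s \<omega>)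
          (\<lambda>x. ennreal (\<Prod>i\<in>UNIV. normal_density 0 (sqrt (t - s)) (x $ i)))) \<and>
     (\<forall>(n::nat) t. 0 \<le> t 0 \<and> (\<forall>k<n. t k < t (Suc k)) \<longrightarrow>
        prob_space.indep_vars P (\<lambda>_. borel) (\<lambda>k \<omega>. W (t (Suc k)) \<omega> - W (t k) \<omega>) {..<n})"

definition batch_divisions :: "nat \<Rightarrow> nat \<Rightarrow> nat set set set" where
  "batch_divisions n p =
     {D. partition_on {1..n * p} D \<and> card D = n \<and> (\<forall>B\<in>D. card B = p)}"

datatype source = Initial nat | Noise nat | Division nat

text \<open>The sources take values in different types, so their joint independence is expressed through
  the sigma-algebras they generate. A Brownian motion generates that of its restriction to
  \<open>[0, \<infinity>)\<close> as a random element of the product space.\<close>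

fun source_events ::
  "'w measure \<Rightarrow> (nat \<Rightarrow> 'w \<Rightarrow> real ^ 'd) \<Rightarrow> (nat \<Rightarrow> real \<Rightarrow> 'w \<Rightarrow> real ^ 'd) \<Rightarrow>
   (nat \<Rightarrow> 'w \<Rightarrow> nat set set) \<Rightarrow> source \<Rightarrow> 'w set set" where
  "source_events P X0 W Cs (Initial i) = sets (vimage_algebra (space P) (X0 i) borel)"
| "source_events P X0 W Cs (Noise i) =
     sets (vimage_algebra (space P) (\<lambda>\<omega>. \<lambda>t\<in>{0..}. W i t \<omega>) (Pi\<^sub>M {0..} (\<lambda>_. borel)))"
| "source_events P X0 W Cs (Division k) =
     sets (vimage_algebra (space P) (Cs k) (count_space UNIV))"

definition rbm_randomness ::
  "nat \<Rightarrow> nat \<Rightarrow> 'w measure \<Rightarrow> (nat \<Rightarrow> 'w \<Rightarrow> real ^ 'd) \<Rightarrow>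
   (nat \<Rightarrow> real \<Rightarrow> 'w \<Rightarrow> real ^ 'd) \<Rightarrow> (nat \<Rightarrow> 'w \<Rightarrow> nat set set) \<Rightarrow> bool" where
  "rbm_randomness n p P X0 W Cs \<longleftrightarrow>
     prob_space P \<and>
     (\<forall>i\<in>{1..n * p}. X0 i \<in> borel_measurable P) \<and>
     (\<forall>i\<in>{1..n * p}. standard_brownian_motion P (W i)) \<and>
     (\<forall>k. Cs k \<in> measurable P (count_space (batch_divisions n p)) \<and>
          distr P (count_space (batch_divisions n p)) (Cs k)
            = uniform_count_measure (batch_divisions n p)) \<and>
     prob_space.indep_sets P (source_events P X0 W Cs)
       (Initial ` {1..n * p} \<union> Noise ` {1..n * p} \<union> range Division)"


section \<open>The two processes\<close>

text \<open>The diffusion coefficient \<open>\<sigma>\<close> is constant, so the stochastic integral is \<open>\<sigma> W\<close> and the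
  equations are read pathwise in integrated form. The drift is Lipschitz in the theorem, so
  solutions are pathwise unique and automatically adapted (up to null sets) to the data.\<close>

definition particle_drift ::
  "(real ^ 'd \<Rightarrow> real ^ 'd) \<Rightarrow> (nat \<Rightarrow> real) \<Rightarrow>
   (nat \<Rightarrow> nat \<Rightarrow> (real ^ 'd) \<times> (real ^ 'd) \<Rightarrow> real ^ 'd) \<Rightarrow>
   nat set \<Rightarrow> nat \<Rightarrow> (nat \<Rightarrow> real ^ 'd) \<Rightarrow> real ^ 'd" where
  "particle_drift b m K I i x =
     b (x i) + (1 / (real (card I) - 1)) *\<^sub>R (\<Sum>j\<in>I - {i}. m j *\<^sub>R K i j (x i, x j))"

definition continuous_process ::
  "real \<Rightarrow> 'w measure \<Rightarrow> (real \<Rightarrow> 'w \<Rightarrow> real ^ 'd) \<Rightarrow> bool" where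
  "continuous_process T P X \<longleftrightarrow>
     (\<forall>t\<in>{0..T}. X t \<in> borel_measurable P) \<and>
     (AE \<omega> in P. continuous_on {0..T} (\<lambda>t. X t \<omega>))"

definition solves_full_system ::
  "real \<Rightarrow> real \<Rightarrow> (real ^ 'd \<Rightarrow> real ^ 'd) \<Rightarrow> nat \<Rightarrow> (nat \<Rightarrow> real) \<Rightarrow>
   (nat \<Rightarrow> nat \<Rightarrow> (real ^ 'd) \<times> (real ^ 'd) \<Rightarrow> real ^ 'd) \<Rightarrow> 'w measure \<Rightarrow>
   (nat \<Rightarrow> 'w \<Rightarrow> real ^ 'd) \<Rightarrow> (nat \<Rightarrow> real \<Rightarrow> 'w \<Rightarrow> real ^ 'd) \<Rightarrow>
   (nat \<Rightarrow> real \<Rightarrow> 'w \<Rightarrow> real ^ 'd) \<Rightarrow> bool" where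
  "solves_full_system T \<sigma> b N m K P X0 W X \<longleftrightarrow>
     (\<forall>i\<in>{1..N}. continuous_process T P (X i)) \<and>
     (AE \<omega> in P. \<forall>i\<in>{1..N}. \<forall>t\<in>{0..T}.
        X i t \<omega> = X0 i \<omega>
          + integral {0..t} (\<lambda>s. particle_drift b m K {1..N} i (\<lambda>j. X j s \<omega>))
          + \<sigma> *\<^sub>R W i t \<omega>)"

text \<open>On \<open>[k\<tau>, (k+1)\<tau>)\<close> the interaction runs inside the batches of the division \<open>Cs k\<close>; continuity
  of the paths joins consecutive intervals.\<close>

definition solves_rbm ::
  "real \<Rightarrow> real \<Rightarrow> (real ^ 'd \<Rightarrow> real ^ 'd) \<Rightarrow> nat \<Rightarrow> real \<Rightarrow> (nat \<Rightarrow> real) \<Rightarrow>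
   (nat \<Rightarrow> nat \<Rightarrow> (real ^ 'd) \<times> (real ^ 'd) \<Rightarrow> real ^ 'd) \<Rightarrow> 'w measure \<Rightarrow>
   (nat \<Rightarrow> 'w \<Rightarrow> real ^ 'd) \<Rightarrow> (nat \<Rightarrow> real \<Rightarrow> 'w \<Rightarrow> real ^ 'd) \<Rightarrow> (nat \<Rightarrow> 'w \<Rightarrow> nat set set) \<Rightarrow>
   (nat \<Rightarrow> real \<Rightarrow> 'w \<Rightarrow> real ^ 'd) \<Rightarrow> bool" where
  "solves_rbm T \<sigma> b N \<tau> m K P X0 W Cs X \<longleftrightarrow>
     (\<forall>i\<in>{1..N}. continuous_process T P (X i)) \<and>
     (AE \<omega> in P. \<forall>i\<in>{1..N}. X i 0 \<omega> = X0 i \<omega>) \<and>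
     (AE \<omega> in P. \<forall>k. \<forall>B\<in>Cs k \<omega>. \<forall>i\<in>B.
        \<forall>t\<in>{real k * \<tau>..<real (Suc k) * \<tau>} \<inter> {0..T}.
          X i t \<omega> = X i (real k * \<tau>) \<omega>
            + integral {real k * \<tau>..t} (\<lambda>s. particle_drift b m K B i (\<lambda>j. X j s \<omega>))
            + \<sigma> *\<^sub>R (W i t \<omega> - W i (real k * \<tau>) \<omega>))"


section \<open>Empirical measure and weak error\<close>

definition particle_weight :: "nat \<Rightarrow> (nat \<Rightarrow> real) \<Rightarrow> nat \<Rightarrow> real" where
  "particle_weight N m j = real N * m j / (\<Sum>l\<in>{1..N}. m l)"

text \<open>The image measure keeps the right total mass at a point occupied by several particles.\<close>

definition empirical_measure ::
  "nat \<Rightarrow> (nat \<Rightarrow> real) \<Rightarrow> (nat \<Rightarrow> real ^ 'd) \<Rightarrow> (real ^ 'd) measure" where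
  "empirical_measure N m x =
     distr (point_measure {1..N} (\<lambda>j. ennreal (particle_weight N m j / real N))) borel x"

definition weak_error ::
  "'w measure \<Rightarrow> nat \<Rightarrow> real \<Rightarrow> (nat \<Rightarrow> real) \<Rightarrow> (real ^ 'd \<Rightarrow> real) \<Rightarrow>
   (nat \<Rightarrow> real \<Rightarrow> 'w \<Rightarrow> real ^ 'd) \<Rightarrow> (nat \<Rightarrow> real \<Rightarrow> 'w \<Rightarrow> real ^ 'd) \<Rightarrow> nat \<Rightarrow> real" where
  "weak_error P N \<tau> m \<phi> X Y k =
     \<bar>1 / real N * (\<Sum>i\<in>{1..N}. particle_weight N m i *
          prob_space.expectation P (\<lambda>\<omega>. \<phi> (Y i (real k * \<tau>) \<omega>)))
      - 1 / real N * (\<Sum>i\<in>{1..N}. particle_weight N m i *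
          prob_space.expectation P (\<lambda>\<omega>. \<phi> (X i (real k * \<tau>) \<omega>)))\<bar>"

definition empirical_weak_error ::
  "'w measure \<Rightarrow> nat \<Rightarrow> real \<Rightarrow> (nat \<Rightarrow> real) \<Rightarrow> (real ^ 'd \<Rightarrow> real) \<Rightarrow>
   (nat \<Rightarrow> real \<Rightarrow> 'w \<Rightarrow> real ^ 'd) \<Rightarrow> (nat \<Rightarrow> real \<Rightarrow> 'w \<Rightarrow> real ^ 'd) \<Rightarrow> nat \<Rightarrow> real" where
  "empirical_weak_error P N \<tau> m \<phi> X Y k =
     \<bar>prob_space.expectation P
         (\<lambda>\<omega>. \<integral>x. \<phi> x \<partial>empirical_measure N m (\<lambda>j. Y j (real k * \<tau>) \<omega>))
      - prob_space.expectation P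
         (\<lambda>\<omega>. \<integral>x. \<phi> x \<partial>empirical_measure N m (\<lambda>j. X j (real k * \<tau>) \<omega>))\<bar>"

end

theory Submission
  imports Defs
begin

text \<open>
  The noise is additive and independent of the divisions, so the initial data and the Brownian paths
  can be frozen. Both systems then become ordinary differential equations, which are replaced by
  their Euler schemes with a step \<open>h = \<tau> / q\<close>; the noise cancels in the difference \<open>d\<close> of the two
  schemes. Averaged over all divisions the batch interaction equals the full one. Within one time
  step, replacing the current division by an independent copy moves the random batch path by
  \<open>O(\<tau>)\<close> only, so the interaction error has mean \<open>O(\<tau>)\<close>, even when tested against \<open>d\<close>. Gronwall's
  inequality first gives a mean square of \<open>d\<close> of order \<open>\<tau>\<close>. The path of the full system does not
  depend on the divisions, so linearising along it bounds the mean of \<open>d\<close> by \<open>O(\<tau>)\<close> too, and Taylor's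
  formula for the test function yields the weak error. All constants are independent of \<open>h\<close>, and
  \<open>q \<rightarrow> \<infinity>\<close> recovers the continuous-time processes.
\<close>

section \<open>Averages over finite sets\<close>

text \<open>The mean square estimate alone would give only order one half; first order has to come
  from cancellation over the divisions. Inside a time step this cancellation is obstructed, because
  the batch state already depends on the current division, and resampling removes the dependence at
  the price of a term of order \<tau>. Boundedness of the kernels makes this price independent of
  the particle positions, hence of the initial data. Through the Euler schemes the divisions of
  \<open>k\<close> time steps become one element of a finite product set: expectations over them are
  the finite averages \<open>avg\<close>, and the estimates are recursions for a discrete Gronwall
  inequality. Uniformity in \<open>N\<close> rests on measuring errors by means over the particles:
  the mean over the partners of a particle, averaged over that particle, is again the mean over all,
  so the recursions close without a factor \<open>N\<close>. The weights enter last, through their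
  upper bound \<open>A / M\<close>.\<close>

definition avg :: "'i set \<Rightarrow> ('i \<Rightarrow> 'v::real_vector) \<Rightarrow> 'v" where
  "avg S f = (1 / real (card S)) *\<^sub>R sum f S"

lemma avg_cong: "S = S' \<Longrightarrow> (\<And>x. x \<in> S' \<Longrightarrow> f x = g x) \<Longrightarrow> avg S f = avg S' g"
  by (simp add: avg_def cong: sum.cong)

lemma avg_add: "avg S (\<lambda>x. f x + g x) = avg S f + avg S g"
  by (simp add: avg_def sum.distrib scaleR_add_right)

lemma avg_diff: "avg S (\<lambda>x. f x - g x) = avg S f - avg S g"
  by (simp add: avg_def sum_subtractf scaleR_diff_right)

lemma avg_linear: "linear g \<Longrightarrow> g (avg S f) = avg S (\<lambda>x. g (f x))"
  by (simp add: avg_def linear_cmul linear_sum)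

lemma avg_scaleR: "avg S (\<lambda>x. r *\<^sub>R f x) = r *\<^sub>R avg S f"
  by (rule avg_linear[symmetric]) (rule linear_scale_self)

lemma avg_mult: "avg S (\<lambda>x. r * f x) = r * (avg S f :: real)"
  using avg_scaleR[of S r f] by simp

lemma avg_const: "finite S \<Longrightarrow> S \<noteq> {} \<Longrightarrow> avg S (\<lambda>x. a) = a"
  by (simp add: avg_def sum_constant_scaleR)

lemma avg_swap: "avg S (\<lambda>x. avg R (\<lambda>y. f x y)) = avg R (\<lambda>y. avg S (\<lambda>x. f x y))"
  unfolding avg_def by (simp add: scaleR_sum_right[symmetric] sum.swap[of _ S R] mult.commute)

lemma avg_mono:
  fixes f g :: "'i \<Rightarrow> real"
  shows "(\<And>x. x \<in> S \<Longrightarrow> f x \<le> g x) \<Longrightarrow> avg S f \<le> avg S g"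
  by (simp add: avg_def divide_right_mono sum_mono)

lemma avg_nonneg:
  fixes f :: "'i \<Rightarrow> real"
  shows "(\<And>x. x \<in> S \<Longrightarrow> 0 \<le> f x) \<Longrightarrow> 0 \<le> avg S f"
  by (simp add: avg_def sum_nonneg)

lemma avg_le_const:
  fixes f :: "'i \<Rightarrow> real"
  assumes "finite S" "S \<noteq> {}" "\<And>x. x \<in> S \<Longrightarrow> f x \<le> a"
  shows "avg S f \<le> a"
  using avg_mono[of S f "\<lambda>_. a"] assms by (simp add: avg_const)

lemma norm_avg_le:
  fixes f :: "'i \<Rightarrow> 'v::real_normed_vector"
  shows "norm (avg S f) \<le> avg S (\<lambda>x. norm (f x))"
  by (simp add: avg_def divide_right_mono norm_sum)

lemma norm_avg_le_const:
  fixes f :: "'i \<Rightarrow> 'v::real_normed_vector"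
  assumes "finite S" "S \<noteq> {}" "\<And>x. x \<in> S \<Longrightarrow> norm (f x) \<le> a"
  shows "norm (avg S f) \<le> a"
  using norm_avg_le avg_le_const assms by (metis (no_types, lifting) order_trans)

text \<open>Every index is missing from exactly one of the inner sums, so all values get the same
  total weight. This turns means over interaction partners back into means over all particles and
  keeps the recursions free of \<open>N\<close>.\<close>

lemma avg_avg_remove:
  fixes a :: "'i \<Rightarrow> 'v::real_vector"
  assumes "finite I" "card I \<ge> 2"
  shows "avg I (\<lambda>i. avg (I - {i}) a) = avg I a"
proof -
  have "avg I (\<lambda>i. avg (I - {i}) a) = avg I (\<lambda>i. (1 / (real (card I) - 1)) *\<^sub>R (sum a I - a i))"
    using assms by (intro avg_cong refl) (simp add: avg_def sum_diff1 of_nat_diff)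
  also have "\<dots> = (1 / (real (card I) - 1)) *\<^sub>R (avg I (\<lambda>_. sum a I) - avg I a)"
    by (simp add: avg_scaleR avg_diff)
  also have "avg I (\<lambda>_. sum a I) = real (card I) *\<^sub>R avg I a"
    using assms by (subst avg_const) (auto simp: avg_def)
  also have "real (card I) *\<^sub>R avg I a - avg I a = (real (card I) - 1) *\<^sub>R avg I a"
    by (simp add: scaleR_diff_left)
  finally show ?thesis using assms by simp
qed

text \<open>Overwriting one coordinate by an independent uniform value preserves the uniform
  distribution, since \<open>(c, D) \<mapsto> (c(k := D), c k)\<close> is an involution.\<close>

lemma avg_PiE_resample:
  fixes f :: "('k \<Rightarrow> 'c) \<Rightarrow> 'v::real_vector"
  assumes k: "k \<in> R" and fin: "finite D" and ne: "D \<noteq> {}"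
  shows "avg (R \<rightarrow>\<^sub>E D) f = avg (R \<rightarrow>\<^sub>E D) (\<lambda>c. avg D (\<lambda>d. f (c(k := d))))"
proof -
  let ?C = "R \<rightarrow>\<^sub>E D"
  let ?s = "\<lambda>(c, d). (c(k := d), c k)"
  have "(\<Sum>(c, d)\<in>?C \<times> D. f (c(k := d))) = (\<Sum>(c, d)\<in>?C \<times> D. f c)"
    by (rule sum.reindex_bij_witness[where i = ?s and j = ?s])
      (use k in \<open>auto simp: PiE_def Pi_def extensional_def\<close>)
  then have *: "(\<Sum>c\<in>?C. \<Sum>d\<in>D. f (c(k := d))) = real (card D) *\<^sub>R sum f ?C"
    by (simp add: sum.cartesian_product[symmetric] sum_constant_scaleR scaleR_sum_right)
  have "avg ?C (\<lambda>c. avg D (\<lambda>d. f (c(k := d))))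
      = (1 / real (card ?C)) *\<^sub>R (1 / real (card D)) *\<^sub>R (\<Sum>c\<in>?C. \<Sum>d\<in>D. f (c(k := d)))"
    unfolding avg_def by (simp add: scaleR_sum_right)
  also have "\<dots> = avg ?C f"
    unfolding * avg_def using fin ne by simp
  finally show ?thesis ..
qed

section \<open>Discrete Gronwall inequality\<close>

lemma discrete_gronwall:
  fixes a :: "nat \<Rightarrow> real"
  assumes "a 0 \<le> 0" and nonneg: "h \<ge> 0" "u \<ge> 0" "v \<ge> 0"
    and step: "\<And>s. s < n \<Longrightarrow> a (Suc s) \<le> (1 + h * u) * a s + h * v"
    and "s \<le> n"
  shows "a s \<le> v * (real s * h) * exp (u * (real s * h))"
  using \<open>s \<le> n\<close>
proof (induction s)
  case 0
  then show ?case using assms(1) by simp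
next
  case (Suc s)
  let ?e = "exp (u * (real (Suc s) * h))"
  have split: "?e = exp (h * u) * exp (u * (real s * h))"
    by (simp add: exp_add[symmetric] algebra_simps)
  \<comment> \<open>By \<open>1 + h * u \<le> exp (h * u)\<close>, one growth factor is absorbed by
    advancing the exponential by one step.\<close>
  have "(1 + h * u) * exp (u * (real s * h)) \<le> ?e"
    unfolding split by (intro mult_right_mono) auto
  then have *: "v * (real s * h) * ((1 + h * u) * exp (u * (real s * h))) \<le> v * (real s * h) * ?e"
    using nonneg by (intro mult_left_mono) auto
  have **: "h * v * 1 \<le> h * v * ?e"
    using nonneg by (intro mult_left_mono) auto
  have "a (Suc s) \<le> (1 + h * u) * a s + h * v" using step Suc.prems by simp
  also have "\<dots> \<le> (1 + h * u) * (v * (real s * h) * exp (u * (real s * h))) + h * v"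
    using Suc nonneg by (intro add_right_mono mult_left_mono) auto
  also have "\<dots> \<le> v * (real s * h) * ?e + h * v * ?e"
    using * ** by (simp add: algebra_simps)
  also have "\<dots> = v * (real (Suc s) * h) * ?e" by (simp add: algebra_simps)
  finally show ?case .
qed

text \<open>The bound increases with the elapsed time, so any upper bound \<open>t\<close> may
  replace it. For the schemes this is the horizon or the length of one time step, and nothing
  depends on the number of Euler steps.\<close>

lemma discrete_gronwall_le:
  fixes a :: "nat \<Rightarrow> real"
  assumes "a 0 \<le> 0" "h \<ge> 0" "u \<ge> 0" "v \<ge> 0"
    and "\<And>s. s < n \<Longrightarrow> a (Suc s) \<le> (1 + h * u) * a s + h * v"
    and "s \<le> n" "real n * h \<le> t"
  shows "a s \<le> v * t * exp (u * t)"
proof -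
  have st: "real s * h \<le> t"
    using assms(2,6,7) by (meson mult_right_mono of_nat_mono order_trans)
  have "a s \<le> v * (real s * h) * exp (u * (real s * h))"
    by (rule discrete_gronwall[OF assms(1-6)])
  also have "\<dots> \<le> v * t * exp (u * t)"
  proof (intro mult_mono)
    have "0 \<le> t" using st assms(2) by (meson mult_nonneg_nonneg of_nat_0_le_iff order_trans)
    then show "0 \<le> v * t" using assms(4) by simp
    show "exp (u * (real s * h)) \<le> exp (u * t)" using st assms(3) by (simp add: mult_left_mono)
  qed (use st assms(2-4) in auto)
  finally show ?thesis .
qed

section \<open>Quadratic approximation of smooth functions\<close>

text \<open>Interface between smoothness and the estimates: a bounded linear part, a Lipschitz bound
  and a quadratic Taylor remainder share one constant, so that \<open>b\<close>, the kernels and the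
  test function can all use the same \<Lambda>.\<close>

definition quadratic_approx ::
  "real \<Rightarrow> ('a::real_normed_vector \<Rightarrow> 'b::real_normed_vector) \<Rightarrow> ('a \<Rightarrow> 'a \<Rightarrow> 'b) \<Rightarrow> bool" where
  "quadratic_approx \<Lambda> f f' \<longleftrightarrow>
     (\<forall>x. linear (f' x)) \<and> (\<forall>x v. norm (f' x v) \<le> \<Lambda> * norm v) \<and>
     (\<forall>x y. norm (f y - f x) \<le> \<Lambda> * norm (y - x)) \<and>
     (\<forall>x y. norm (f y - f x - f' x (y - x)) \<le> \<Lambda> * (norm (y - x))\<^sup>2)"

lemma quadratic_approx_mono:
  assumes "quadratic_approx \<Lambda> f f'" "\<Lambda> \<le> \<Lambda>'"
  shows "quadratic_approx \<Lambda>' f f'"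
proof -
  have "\<Lambda> * norm z \<le> \<Lambda>' * norm z" "\<Lambda> * (norm z)\<^sup>2 \<le> \<Lambda>' * (norm z)\<^sup>2" for z :: 'a
    using assms(2) by (auto intro: mult_right_mono)
  then show ?thesis using assms(1) unfolding quadratic_approx_def by (meson order_trans)
qed

lemma linear_norm_le_Basis:
  fixes g :: "'a::euclidean_space \<Rightarrow> 'b::real_normed_vector"
  assumes "linear g" and bound: "\<And>u. u \<in> Basis \<Longrightarrow> norm (g u) \<le> l"
  shows "norm (g v) \<le> real DIM('a) * l * norm v"
proof -
  have "g v = g (\<Sum>u\<in>Basis. (v \<bullet> u) *\<^sub>R u)" by (simp add: euclidean_representation)
  also have "\<dots> = (\<Sum>u\<in>Basis. (v \<bullet> u) *\<^sub>R g u)"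
    using assms(1) by (simp add: linear_sum linear_cmul)
  finally have "norm (g v) \<le> (\<Sum>u\<in>Basis. norm ((v \<bullet> u) *\<^sub>R g u))"
    by (metis norm_sum)
  also have "\<dots> \<le> (\<Sum>u\<in>(Basis::'a set). norm v * l)"
    using bound by (intro sum_mono) (auto intro!: mult_mono simp: Basis_le_norm)
  finally show ?thesis by (simp add: algebra_simps)
qed

text \<open>For the remainder, the mean value theorem makes each first partial derivative Lipschitz
  and is then applied to \<open>f\<close> minus its linear part. Each passage from basis directions
  to arbitrary ones costs a factor \<open>DIM('a)\<close>; two of them occur, hence the square in
  \<Lambda>.\<close>

lemma quadratic_approx_frechet:
  fixes f :: "'a::euclidean_space \<Rightarrow> 'b::euclidean_space"
  assumes "Ck k f" "derivs_bounded_by S l f" "k \<ge> 2" "{1, 2} \<subseteq> S"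
  defines "\<Lambda> \<equiv> (real DIM('a))\<^sup>2 * l"
  shows "quadratic_approx \<Lambda> f (\<lambda>x. frechet_derivative f (at x))"
proof -
  let ?f' = "\<lambda>x. frechet_derivative f (at x)"
  let ?n = "real DIM('a)"
  have "f differentiable at x" for x
    using assms(1,3) unfolding Ck_def by (auto dest!: spec[of _ "[]"])
  then have der: "(f has_derivative ?f' x) (at x)" for x
    by (simp add: frechet_derivative_works)
  then have lin: "linear (?f' x)" for x
    by (blast intro: has_derivative_linear)
  have b1: "norm (?f' x u) \<le> l" if "u \<in> Basis" for x u
    using assms(2,4) that unfolding derivs_bounded_by_def by (auto dest!: spec[of _ "[u]"])
  obtain u0 :: 'a where "u0 \<in> Basis" by (meson nonempty_Basis ex_in_conv)
  then have l: "l \<ge> 0" using b1[of u0] norm_ge_zero order_trans by blast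
  have n: "?n \<ge> 1" by (simp add: Suc_leI)
  have f'_bound: "norm (?f' x v) \<le> ?n * l * norm v" for x v
    using lin b1 by (rule linear_norm_le_Basis)
  have lip1: "norm (?f' y u - ?f' x u) \<le> ?n * l * norm (y - x)" if u: "u \<in> Basis" for x y u
  proof -
    let ?g = "\<lambda>x. ?f' x u"
    have "?g differentiable at x" for x
      using assms(1,3) u unfolding Ck_def by (auto dest!: spec[of _ "[u]"])
    then have gder: "(?g has_derivative frechet_derivative ?g (at x)) (at x)" for x
      by (simp add: frechet_derivative_works)
    have "norm (frechet_derivative ?g (at x) v) \<le> l" if "v \<in> Basis" for x v
      using assms(2,4) that u unfolding derivs_bounded_by_def by (auto dest!: spec[of _ "[v, u]"] simp: numeral_2_eq_2)
    then have "onorm (frechet_derivative ?g (at x)) \<le> ?n * l" for x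
      using gder by (intro onorm_bound linear_norm_le_Basis) (auto intro: has_derivative_linear simp: l)
    then show ?thesis
      using gder by (intro differentiable_bound[of UNIV]) auto
  qed
  have f'_lip: "norm (?f' y v - ?f' x v) \<le> ?n * (?n * l * norm (y - x)) * norm v" for x y v
    using lip1 lin by (intro linear_norm_le_Basis[of "\<lambda>v. ?f' y v - ?f' x v"]) (auto intro: linear_compose_sub)
  have ll: "?n * l \<le> \<Lambda>"
    using n l unfolding \<Lambda>_def power2_eq_square by (intro mult_right_mono) auto
  have "norm (f y - f x) \<le> ?n * l * norm (y - x)" for x y
    using der f'_bound l by (intro differentiable_bound[of UNIV]) (auto intro!: onorm_bound)
  moreover have "norm (f y - f x - ?f' x (y - x)) \<le> \<Lambda> * (norm (y - x))\<^sup>2" for x y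
  proof -
    \<comment> \<open>On the ball of radius \<open>norm (y - x)\<close> the derivative of
      \<open>f\<close> minus its linear part at \<open>x\<close> is itself at most
      \<open>\<Lambda> * norm (y - x)\<close>; this produces the second power.\<close>
    have "norm ((f y - ?f' x y) - (f x - ?f' x x)) \<le> \<Lambda> * norm (y - x) * norm (y - x)"
    proof (rule differentiable_bound[of "cball x (norm (y - x))"])
      fix z assume z: "z \<in> cball x (norm (y - x))"
      show "((\<lambda>y. f y - ?f' x y) has_derivative (\<lambda>v. ?f' z v - ?f' x v)) (at z within cball x (norm (y - x)))"
        by (intro has_derivative_diff has_derivative_at_withinI[OF der]
            linear_imp_has_derivative lin)
      show "onorm (\<lambda>v. ?f' z v - ?f' x v) \<le> \<Lambda> * norm (y - x)"
      proof (rule onorm_bound)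
        fix v
        have zx: "norm (z - x) \<le> norm (y - x)" using z by (simp add: dist_norm norm_minus_commute)
        have "norm (?f' z v - ?f' x v) \<le> ?n * (?n * l * norm (z - x)) * norm v" by (rule f'_lip)
        also have "\<dots> = \<Lambda> * norm (z - x) * norm v"
          by (simp add: \<Lambda>_def power2_eq_square)
        also have "\<dots> \<le> \<Lambda> * norm (y - x) * norm v"
          using zx l by (intro mult_right_mono mult_left_mono) (auto simp: \<Lambda>_def)
        finally show "norm (?f' z v - ?f' x v) \<le> \<Lambda> * norm (y - x) * norm v" .
      qed (simp add: \<Lambda>_def l)
    qed (auto simp: dist_norm norm_minus_commute)
    moreover have "(f y - ?f' x y) - (f x - ?f' x x) = f y - f x - ?f' x (y - x)"
      using lin[of x] by (simp add: linear_diff algebra_simps)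
    ultimately show ?thesis by (simp add: power2_eq_square mult.assoc)
  qed
  moreover have "?n * l * norm v \<le> \<Lambda> * norm v" for v :: 'a
    using ll by (rule mult_right_mono) simp
  ultimately show ?thesis
    unfolding quadratic_approx_def using lin f'_bound by (blast intro: order_trans)
qed

section \<open>Random divisions into batches\<close>

definition batch_of :: "'a set set \<Rightarrow> 'a \<Rightarrow> 'a set" where
  "batch_of D i = (THE B. B \<in> D \<and> i \<in> B)"

lemma batch_of_eq: "partition_on A D \<Longrightarrow> B \<in> D \<Longrightarrow> i \<in> B \<Longrightarrow> batch_of D i = B"
  unfolding batch_of_def by (rule the_equality) (auto simp: partition_on_def disjoint_def)

lemma batch_divisionsD:
  assumes "D \<in> batch_divisions n p" "i \<in> {1..n * p}"
  shows "batch_of D i \<in> D" "i \<in> batch_of D i" "batch_of D i \<subseteq> {1..n * p}"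
    "card (batch_of D i) = p"
proof -
  have part: "partition_on {1..n * p} D" and "\<forall>B\<in>D. card B = p"
    using assms(1) by (auto simp: batch_divisions_def)
  moreover obtain B where "B \<in> D" "i \<in> B"
    using assms(2) partition_onD1[OF part] by (metis UnionE)
  ultimately show "batch_of D i \<in> D" "i \<in> batch_of D i" "batch_of D i \<subseteq> {1..n * p}"
    "card (batch_of D i) = p"
    using batch_of_eq[OF part] partition_onD1[OF part] by auto
qed

lemma finite_batch_divisions: "finite (batch_divisions n p)"
proof (rule finite_subset)
  show "batch_divisions n p \<subseteq> Pow (Pow {1..n * p})"
    unfolding batch_divisions_def partition_on_def by blast
qed simp

text \<open>Relabelling the particles is the symmetry behind the uniform division. Injectivity on
  the index set keeps the number of batches and their sizes.\<close>

lemma image_batch_divisions: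
  assumes bij: "bij_betw \<pi> {1..n * p} {1..n * p}" and D: "D \<in> batch_divisions n p"
  shows "(\<lambda>B. \<pi> ` B) ` D \<in> batch_divisions n p"
proof -
  let ?A = "{1..n * p}"
  have part: "partition_on ?A D" and c: "card D = n" "\<forall>B\<in>D. card B = p"
    using D by (auto simp: batch_divisions_def)
  have inj: "inj_on \<pi> ?A" and im: "\<pi> ` ?A = ?A"
    using bij by (auto simp: bij_betw_def)
  have sub: "B \<subseteq> ?A" if "B \<in> D" for B using part that by (auto simp: partition_on_def)
  have "inj_on (\<lambda>B. \<pi> ` B) D"
    using sub inj by (intro inj_onI) (metis inj_on_image_eq_iff)
  then have "card ((\<lambda>B. \<pi> ` B) ` D) = n" using c by (simp add: card_image)
  moreover have "card (\<pi> ` B) = p" if "B \<in> D" for B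
    using that c sub inj by (metis card_image inj_on_subset)
  moreover have "{} \<notin> (\<lambda>B. \<pi> ` B) ` D"
    using part by (auto simp: partition_on_def)
  then have "partition_on (\<pi> ` ?A) ((\<lambda>B. \<pi> ` B) ` D)"
    using partition_on_inj_image[OF part inj] by simp
  ultimately show ?thesis
    unfolding batch_divisions_def im by (auto simp: im)
qed

text \<open>Swapping \<open>j\<close> and \<open>k\<close> fixes \<open>i\<close> and maps its batch
  to the image batch, so it exchanges the divisions that put \<open>j\<close> beside
  \<open>i\<close> with those that put \<open>k\<close> there. Being an involution, the swap is a
  bijection, and the divisions never have to be counted.\<close>

lemma card_together_symmetric:
  assumes i: "i \<in> {1..n * p}" and j: "j \<in> {1..n * p} - {i}" and k: "k \<in> {1..n * p} - {i}"
  shows "card {D \<in> batch_divisions n p. j \<in> batch_of D i} =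
         card {D \<in> batch_divisions n p. k \<in> batch_of D i}"
proof -
  let ?\<pi> = "Transposition.transpose j k"
  let ?f = "\<lambda>D. (\<lambda>B. ?\<pi> ` B) ` D"
  have bij: "bij_betw ?\<pi> {1..n * p} {1..n * p}"
    using j k by (intro bij_betwI[of _ _ _ ?\<pi>]) (auto simp: Transposition.transpose_def)
  have mem: "?f D \<in> batch_divisions n p" if "D \<in> batch_divisions n p" for D
    by (rule image_batch_divisions[OF bij that])
  have inv: "?f (?f D) = D" for D
    by (simp add: image_image)
  have fi: "?\<pi> i = i" using j k by (auto simp: Transposition.transpose_def)
  have batch: "batch_of (?f D) i = ?\<pi> ` batch_of D i" if D: "D \<in> batch_divisions n p" for D
  proof (rule batch_of_eq)
    show "partition_on {1..n * p} (?f D)" using mem[OF D] by (simp add: batch_divisions_def)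
    show "?\<pi> ` batch_of D i \<in> ?f D" using batch_divisionsD[OF D i] by blast
    show "i \<in> ?\<pi> ` batch_of D i" using batch_divisionsD[OF D i] fi by (metis imageI)
  qed
  show ?thesis
  proof (rule bij_betw_same_card[of ?f], rule bij_betwI[of _ _ _ ?f])
    show "?f \<in> {D \<in> batch_divisions n p. j \<in> batch_of D i} \<rightarrow> {D \<in> batch_divisions n p. k \<in> batch_of D i}"
      using mem by (auto simp: batch intro!: image_eqI[of k _ j])
    show "?f \<in> {D \<in> batch_divisions n p. k \<in> batch_of D i} \<rightarrow> {D \<in> batch_divisions n p. j \<in> batch_of D i}"
      using mem by (auto simp: batch intro!: image_eqI[of j _ k])
  qed (simp_all only: inv)
qed

text \<open>Double counting of the pairs formed by a division and a partner of \<open>i\<close> in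
  it.\<close>

lemma sum_batch:
  fixes g :: "nat \<Rightarrow> 'v::real_vector"
  assumes i: "i \<in> {1..n * p}"
  shows "(\<Sum>D\<in>batch_divisions n p. sum g (batch_of D i - {i})) =
    (\<Sum>j\<in>{1..n * p} - {i}. real (card {D \<in> batch_divisions n p. j \<in> batch_of D i}) *\<^sub>R g j)"
proof -
  let ?D = "batch_divisions n p" and ?I = "{1..n * p} - {i}"
  let ?c = "\<lambda>j. real (card {D \<in> ?D. j \<in> batch_of D i})"
  have fin: "finite ?D" by (rule finite_batch_divisions)
  have sub: "batch_of D i - {i} = {j \<in> ?I. j \<in> batch_of D i}" if "D \<in> ?D" for D
    using batch_divisionsD[OF that i] by auto
  have "(\<Sum>D\<in>?D. sum g (batch_of D i - {i})) = (\<Sum>D\<in>?D. \<Sum>j\<in>?I. if j \<in> batch_of D i then g j else 0)"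
    by (intro sum.cong[OF refl]) (simp only: sub sum.inter_filter finite_Diff finite_atLeastAtMost)
  also have "\<dots> = (\<Sum>j\<in>?I. \<Sum>D\<in>?D. if j \<in> batch_of D i then g j else 0)"
    by (rule sum.swap)
  also have "\<dots> = (\<Sum>j\<in>?I. ?c j *\<^sub>R g j)"
    using fin by (intro sum.cong refl) (simp add: sum.inter_filter[symmetric] sum_constant_scaleR)
  finally show ?thesis .
qed

text \<open>Unbiasedness of random batches. By symmetry every \<open>j\<close> shares the batch of
  \<open>i\<close> equally often; the common count \<open>q\<close> is found from
  \<open>sum_batch\<close> with the constant function 1, which sees \<open>p - 1\<close> partners
  per division.\<close>

lemma avg_batch:
  fixes g :: "nat \<Rightarrow> 'v::real_vector"
  assumes i: "i \<in> {1..n * p}" and p: "p \<ge> 2" and ne: "batch_divisions n p \<noteq> {}"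
  shows "avg (batch_divisions n p) (\<lambda>D. avg (batch_of D i - {i}) g) = avg ({1..n * p} - {i}) g"
proof -
  let ?D = "batch_divisions n p" and ?I = "{1..n * p} - {i}"
  let ?c = "\<lambda>j. real (card {D \<in> ?D. j \<in> batch_of D i})"
  have fin: "finite ?D" by (rule finite_batch_divisions)
  have card: "card (batch_of D i - {i}) = p - 1" if "D \<in> ?D" for D
    using batch_divisionsD[OF that i] by (metis card_Diff_singleton)
  obtain D0 where D0: "D0 \<in> ?D" using ne by blast
  have "p \<le> n * p"
    using batch_divisionsD[OF D0 i] by (metis card_atLeastAtMost card_mono diff_Suc_1 finite_atLeastAtMost)
  then have "2 \<le> n * p" using p by linarith
  moreover have "card ?I = n * p - 1" using i by simp
  ultimately have cI: "real (card ?I) > 0" "card ?I \<noteq> 0" by linarith+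
  from cI(2) have "?I \<noteq> {}" by (rule contrapos_nn) (simp only: card.empty)
  then obtain j0 where j0: "j0 \<in> ?I" by blast
  define q where "q = ?c j0"
  have q: "?c j = q" if "j \<in> ?I" for j
    unfolding q_def using card_together_symmetric[OF i that j0] by simp
  have "real (card ?D) * real (p - 1) = (\<Sum>D\<in>?D. \<Sum>j\<in>batch_of D i - {i}. 1::real)"
    by (simp add: card)
  also have "\<dots> = (\<Sum>j\<in>?I. ?c j *\<^sub>R 1)" by (rule sum_batch[OF i])
  also have "\<dots> = real (card ?I) * q" using q by simp
  finally have count: "real (card ?D) * real (p - 1) = real (card ?I) * q" .
  have pos: "real (card ?D) > 0" "real (p - 1) > 0" using fin ne p by (auto simp: card_gt_0_iff)
  have "1 / a * (1 / b) * q = 1 / c" if "a > 0" "b > 0" "c > 0" "a * b = c * q" for a b c :: real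
    using that by (auto simp: divide_simps mult.commute)
  from this[OF pos cI(1) count]
  have frac: "1 / real (card ?D) * (1 / real (p - 1)) * q = 1 / real (card ?I)" .
  have "avg ?D (\<lambda>D. avg (batch_of D i - {i}) g)
      = (1 / real (card ?D) * (1 / real (p - 1))) *\<^sub>R (\<Sum>D\<in>?D. sum g (batch_of D i - {i}))"
    unfolding avg_def by (simp add: card scaleR_sum_right[symmetric])
  also have "\<dots> = (1 / real (card ?D) * (1 / real (p - 1))) *\<^sub>R (\<Sum>j\<in>?I. q *\<^sub>R g j)"
    unfolding sum_batch[OF i] using q by simp
  also have "\<dots> = (1 / real (card ?D) * (1 / real (p - 1)) * q) *\<^sub>R sum g ?I"
    by (simp add: scaleR_sum_right[symmetric])
  also have "\<dots> = avg ?I g" unfolding frac avg_def ..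
  finally show ?thesis .
qed

section \<open>Interacting particles\<close>

text \<open>\<open>I\<close> is either the whole index set or a batch. Reading the prefactor
  \<open>1 / (card I - 1)\<close> as an average over the partners gives both cases the same
  rules.\<close>

definition interaction ::
  "(nat \<Rightarrow> real) \<Rightarrow> (nat \<Rightarrow> nat \<Rightarrow> (real ^ 'd) \<times> (real ^ 'd) \<Rightarrow> real ^ 'd) \<Rightarrow>
   nat set \<Rightarrow> nat \<Rightarrow> (nat \<Rightarrow> real ^ 'd) \<Rightarrow> real ^ 'd" where
  "interaction m K I i x = avg (I - {i}) (\<lambda>j. m j *\<^sub>R K i j (x i, x j))"

lemma particle_drift_eq:
  assumes "finite I" "i \<in> I"
  shows "particle_drift b m K I i x = b (x i) + interaction m K I i x"
proof -
  have "card I \<ge> 1" using assms by (metis card_0_eq empty_iff less_one linorder_not_le)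
  then show ?thesis
    using assms by (simp add: particle_drift_def interaction_def avg_def of_nat_diff)
qed

lemma avg_Pair: "avg S (\<lambda>c. (f c, g c)) = (avg S f, avg S g)"
  by (simp add: avg_def prod_eq_iff fst_sum snd_sum)

text \<open>The kernels are bounded themselves, while \<open>b\<close> is controlled only through
  its increments and may grow. Existence of a division is assumed here because it follows at once
  from a random division taking values in the set.\<close>

locale interacting_particles =
  fixes N n p :: nat and A \<Lambda> :: real and b :: "real ^ 'd \<Rightarrow> real ^ 'd"
    and b' :: "real ^ 'd \<Rightarrow> real ^ 'd \<Rightarrow> real ^ 'd" and m :: "nat \<Rightarrow> real"
    and K :: "nat \<Rightarrow> nat \<Rightarrow> (real ^ 'd) \<times> (real ^ 'd) \<Rightarrow> real ^ 'd"
    and K' :: "nat \<Rightarrow> nat \<Rightarrow> (real ^ 'd) \<times> (real ^ 'd) \<Rightarrow> (real ^ 'd) \<times> (real ^ 'd) \<Rightarrow> real ^ 'd"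
  assumes N: "N = n * p" and n: "n \<ge> 1" and p: "p \<ge> 2"
    and divisions: "batch_divisions n p \<noteq> {}"
    and \<Lambda>_nonneg: "\<Lambda> \<ge> 0"
    and b: "quadratic_approx \<Lambda> b b'"
    and K: "\<And>i j. i \<in> {1..N} \<Longrightarrow> j \<in> {1..N} \<Longrightarrow> quadratic_approx \<Lambda> (K i j) (K' i j)"
    and K_bound: "\<And>i j z. i \<in> {1..N} \<Longrightarrow> j \<in> {1..N} \<Longrightarrow> norm (K i j z) \<le> \<Lambda>"
    and m: "\<And>j. j \<in> {1..N} \<Longrightarrow> 0 \<le> m j \<and> m j \<le> A"
begin

abbreviation "I \<equiv> {1..N}"
abbreviation "\<D> \<equiv> batch_divisions n p"
abbreviation "B \<equiv> A * \<Lambda>"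

lemma N_ge_2: "N \<ge> 2"
  unfolding N using mult_le_mono[OF n p] by simp

lemma I_ne: "I \<noteq> {}" "finite I" "card I = N"
  using N_ge_2 by auto

lemma A_nonneg: "A \<ge> 0"
  using m[of 1] N_ge_2 by auto

lemma B_nonneg: "B \<ge> 0"
  using A_nonneg \<Lambda>_nonneg by simp

lemmas \<D>_finite = finite_batch_divisions[of n p]

lemma batch_of_division:
  assumes "D \<in> \<D>" "i \<in> I"
  shows "i \<in> batch_of D i" "batch_of D i \<subseteq> I" "card (batch_of D i) \<ge> 2" "finite (batch_of D i)"
    "batch_of D i - {i} \<noteq> {}"
proof -
  show *: "i \<in> batch_of D i" "batch_of D i \<subseteq> I" "card (batch_of D i) \<ge> 2"
    using batch_divisionsD[OF assms(1)] assms(2) p by (simp_all add: N)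
  then show "finite (batch_of D i)" using finite_subset by blast
  show "batch_of D i - {i} \<noteq> {}"
    using *(1,3) by (metis card_Diff_singleton card.empty diff_is_0_eq not_less_eq_eq numeral_2_eq_2 le_SucE order_refl Suc_1)
qed

lemma I_minus_ne: "I - {i} \<noteq> {}"
proof -
  have "N \<in> I - {i} \<or> 1 \<in> I - {i}" using N_ge_2 by simp
  then show ?thesis by (metis empty_iff)
qed

context
  fixes J i assumes J: "J \<subseteq> I" "i \<in> I" "J - {i} \<noteq> {}"
begin

lemma finite_J: "finite (J - {i})"
  using J finite_subset by blast

text \<open>The kernel bound gives an estimate free of the positions. It controls what a change of
  division can do to the drift, where no small displacement is available.\<close>

lemma norm_interaction_le: "norm (interaction m K J i x) \<le> B"
  unfolding interaction_def
proof (rule norm_avg_le_const[OF finite_J J(3)])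
  fix j assume "j \<in> J - {i}"
  then have "j \<in> I" using J by blast
  then show "norm (m j *\<^sub>R K i j (x i, x j)) \<le> B"
    using m[of j] K_bound[of i j] J(2) by (auto intro!: mult_mono)
qed

text \<open>The displacement of the partners stays an average, so that averaging over
  \<open>i\<close> later returns the particle mean. The uniform form below serves for stability
  under resampling and for the Lipschitz condition of the time discretisation.\<close>

lemma norm_interaction_diff_le:
  "norm (interaction m K J i y - interaction m K J i x)
    \<le> B * (norm (y i - x i) + avg (J - {i}) (\<lambda>j. norm (y j - x j)))"
proof -
  have "norm (interaction m K J i y - interaction m K J i x)
      = norm (avg (J - {i}) (\<lambda>j. m j *\<^sub>R (K i j (y i, y j) - K i j (x i, x j))))"
    unfolding interaction_def by (simp add: avg_diff[symmetric] scaleR_diff_right)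
  also have "\<dots> \<le> avg (J - {i}) (\<lambda>j. norm (m j *\<^sub>R (K i j (y i, y j) - K i j (x i, x j))))"
    by (rule norm_avg_le)
  also have "\<dots> \<le> avg (J - {i}) (\<lambda>j. B * (norm (y i - x i) + norm (y j - x j)))"
  proof (rule avg_mono)
    fix j assume "j \<in> J - {i}"
    then have j: "j \<in> I" using J by blast
    have "norm (K i j (y i, y j) - K i j (x i, x j)) \<le> \<Lambda> * norm ((y i, y j) - (x i, x j))"
      using K[OF J(2) j] unfolding quadratic_approx_def by blast
    also have "\<dots> \<le> \<Lambda> * (norm (y i - x i) + norm (y j - x j))"
      using \<Lambda>_nonneg by (intro mult_left_mono) (simp_all add: norm_Pair_le)
    finally show "norm (m j *\<^sub>R (K i j (y i, y j) - K i j (x i, x j))) \<le> B * (norm (y i - x i) + norm (y j - x j))"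
      using m[OF j] by (simp add: mult.assoc mult_mono)
  qed
  also have "\<dots> = B * (norm (y i - x i) + avg (J - {i}) (\<lambda>j. norm (y j - x j)))"
    using J(3) finite_J by (simp add: avg_mult avg_add avg_const)
  finally show ?thesis .
qed

lemma norm_interaction_diff_le_uniform:
  assumes "\<And>j. j \<in> I \<Longrightarrow> norm (y j - x j) \<le> \<delta>"
  shows "norm (interaction m K J i y - interaction m K J i x) \<le> 2 * B * \<delta>"
proof -
  have "avg (J - {i}) (\<lambda>j. norm (y j - x j)) \<le> \<delta>"
    using assms J by (intro avg_le_const finite_J) auto
  then have "B * (norm (y i - x i) + avg (J - {i}) (\<lambda>j. norm (y j - x j))) \<le> B * (\<delta> + \<delta>)"
    using assms J B_nonneg by (intro mult_left_mono add_mono) auto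
  then show ?thesis using norm_interaction_diff_le[of y x] by (simp add: algebra_simps)
qed

end

text \<open>The state \<open>x\<close> must not depend on \<open>D\<close>. Inside a time step the
  state of the batch scheme does, so this identity cannot be applied to it directly.\<close>

lemma avg_interaction:
  assumes "i \<in> I"
  shows "avg \<D> (\<lambda>D. interaction m K (batch_of D i) i x) = interaction m K I i x"
  unfolding interaction_def using assms p divisions unfolding N by (rule avg_batch)

text \<open>The derivative of the full interaction at \<open>x\<close> in direction
  \<open>d\<close>. The kernels act on pairs, so each term involves the displacement of
  \<open>i\<close> and that of one partner.\<close>

definition interaction' :: "nat \<Rightarrow> (nat \<Rightarrow> real ^ 'd) \<Rightarrow> (nat \<Rightarrow> real ^ 'd) \<Rightarrow> real ^ 'd" where
  "interaction' i x d = avg (I - {i}) (\<lambda>j. m j *\<^sub>R K' i j (x i, x j) (d i, d j))"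

text \<open>The base point \<open>x\<close> is the same for all \<open>c\<close>, so linearity of
  \<open>K' i j (x i, x j)\<close> lets the average pass through. A base point depending on the
  division would not allow this.\<close>

lemma interaction'_avg:
  assumes "i \<in> I"
  shows "interaction' i x (\<lambda>j. avg S (\<lambda>c. d c j)) = avg S (\<lambda>c. interaction' i x (d c))"
proof -
  have "K' i j (x i, x j) (avg S (\<lambda>c. d c i), avg S (\<lambda>c. d c j))
      = avg S (\<lambda>c. K' i j (x i, x j) (d c i, d c j))" if "j \<in> I - {i}" for j
    using K[OF assms, of j] that unfolding quadratic_approx_def
    by (simp add: avg_Pair[symmetric] avg_linear)
  then have "interaction' i x (\<lambda>j. avg S (\<lambda>c. d c j))
      = avg (I - {i}) (\<lambda>j. avg S (\<lambda>c. m j *\<^sub>R K' i j (x i, x j) (d c i, d c j)))"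
    unfolding interaction'_def by (intro avg_cong refl) (simp add: avg_scaleR)
  then show ?thesis unfolding interaction'_def by (simp add: avg_swap[of S])
qed

lemma norm_interaction'_le:
  assumes "i \<in> I"
  shows "norm (interaction' i x d) \<le> B * (norm (d i) + avg (I - {i}) (\<lambda>j. norm (d j)))"
proof -
  have "norm (interaction' i x d) \<le> avg (I - {i}) (\<lambda>j. norm (m j *\<^sub>R K' i j (x i, x j) (d i, d j)))"
    unfolding interaction'_def by (rule norm_avg_le)
  also have "\<dots> \<le> avg (I - {i}) (\<lambda>j. B * (norm (d i) + norm (d j)))"
  proof (rule avg_mono)
    fix j assume j: "j \<in> I - {i}"
    have "norm (K' i j (x i, x j) (d i, d j)) \<le> \<Lambda> * norm (d i, d j)"
      using K[OF assms, of j] j unfolding quadratic_approx_def by blast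
    also have "\<dots> \<le> \<Lambda> * (norm (d i) + norm (d j))"
      using \<Lambda>_nonneg by (intro mult_left_mono norm_Pair_le)
    finally show "norm (m j *\<^sub>R K' i j (x i, x j) (d i, d j)) \<le> B * (norm (d i) + norm (d j))"
      using m[of j] j by (simp add: mult.assoc mult_mono)
  qed
  also have "\<dots> = B * (norm (d i) + avg (I - {i}) (\<lambda>j. norm (d j)))"
    using I_minus_ne by (simp add: avg_mult avg_add avg_const)
  finally show ?thesis .
qed

text \<open>Each kernel remainder is quadratic in the norm of a pair, which splits into the squares
  of the two displacements. After averaging over \<open>i\<close> and the divisions only the mean
  square error remains.\<close>

lemma norm_interaction_taylor_le:
  assumes "i \<in> I"
  shows "norm (interaction m K I i y - interaction m K I i x - interaction' i x (\<lambda>j. y j - x j))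
    \<le> 2 * B * ((norm (y i - x i))\<^sup>2 + avg (I - {i}) (\<lambda>j. (norm (y j - x j))\<^sup>2))"
proof -
  let ?r = "\<lambda>j. K i j (y i, y j) - K i j (x i, x j) - K' i j (x i, x j) (y i - x i, y j - x j)"
  have "norm (interaction m K I i y - interaction m K I i x - interaction' i x (\<lambda>j. y j - x j))
      = norm (avg (I - {i}) (\<lambda>j. m j *\<^sub>R ?r j))"
    unfolding interaction_def interaction'_def by (simp add: avg_diff[symmetric] scaleR_diff_right)
  also have "\<dots> \<le> avg (I - {i}) (\<lambda>j. norm (m j *\<^sub>R ?r j))"
    by (rule norm_avg_le)
  also have "\<dots> \<le> avg (I - {i}) (\<lambda>j. 2 * B * ((norm (y i - x i))\<^sup>2 + (norm (y j - x j))\<^sup>2))"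
  proof (rule avg_mono)
    fix j assume j: "j \<in> I - {i}"
    have "norm (?r j) \<le> \<Lambda> * (norm ((y i, y j) - (x i, x j)))\<^sup>2"
      using K[OF assms, of j] j unfolding quadratic_approx_def by (metis DiffD1 diff_Pair)
    also have "\<dots> \<le> \<Lambda> * (2 * ((norm (y i - x i))\<^sup>2 + (norm (y j - x j))\<^sup>2))"
      using \<Lambda>_nonneg by (intro mult_left_mono) (simp_all add: norm_Pair)
    finally have "norm (?r j) \<le> \<Lambda> * (2 * ((norm (y i - x i))\<^sup>2 + (norm (y j - x j))\<^sup>2))" .
    then have "m j * norm (?r j) \<le> A * (\<Lambda> * (2 * ((norm (y i - x i))\<^sup>2 + (norm (y j - x j))\<^sup>2)))"
      using m[of j] j A_nonneg by (intro mult_mono) auto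
    then show "norm (m j *\<^sub>R ?r j) \<le> 2 * B * ((norm (y i - x i))\<^sup>2 + (norm (y j - x j))\<^sup>2)"
      using m[of j] j by (simp add: mult.assoc mult.left_commute)
  qed
  also have "\<dots> = 2 * B * ((norm (y i - x i))\<^sup>2 + avg (I - {i}) (\<lambda>j. (norm (y j - x j))\<^sup>2))"
    using I_minus_ne by (simp add: avg_mult avg_add avg_const)
  finally show ?thesis .
qed

definition fluctuation :: "nat set set \<Rightarrow> nat \<Rightarrow> (nat \<Rightarrow> real ^ 'd) \<Rightarrow> real ^ 'd" where
  "fluctuation D i x = interaction m K (batch_of D i) i x - interaction m K I i x"

lemma avg_fluctuation: "i \<in> I \<Longrightarrow> avg \<D> (\<lambda>D. fluctuation D i x) = 0"
  unfolding fluctuation_def using divisions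
  by (simp add: avg_diff avg_interaction avg_const \<D>_finite)

lemma norm_fluctuation_le: "D \<in> \<D> \<Longrightarrow> i \<in> I \<Longrightarrow> norm (fluctuation D i x) \<le> 2 * B"
  unfolding fluctuation_def
  using norm_triangle_ineq4[of "interaction m K (batch_of D i) i x" "interaction m K I i x"]
    norm_interaction_le[of "batch_of D i" i x] norm_interaction_le[of I i x]
    batch_of_division I_minus_ne by fastforce

lemma norm_fluctuation_diff_le:
  assumes "D \<in> \<D>" "i \<in> I" "\<And>j. j \<in> I \<Longrightarrow> norm (y j - x j) \<le> \<delta>"
  shows "norm (fluctuation D i y - fluctuation D i x) \<le> 4 * B * \<delta>"
proof -
  have "norm (fluctuation D i y - fluctuation D i x)
      \<le> norm (interaction m K (batch_of D i) i y - interaction m K (batch_of D i) i x)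
        + norm (interaction m K I i y - interaction m K I i x)"
    unfolding fluctuation_def
    by (rule order_trans[OF _ norm_triangle_ineq4]) (simp add: algebra_simps)
  also have "\<dots> \<le> 2 * B * \<delta> + 2 * B * \<delta>"
    using assms batch_of_division[of D i] I_minus_ne
    by (intro add_mono norm_interaction_diff_le_uniform) auto
  finally show ?thesis by simp
qed

end

section \<open>The Euler schemes\<close>

text \<open>The drift may vary with the step number, which is how changing divisions are encoded;
  \<open>w r i\<close> is the increment of the forcing over step \<open>r\<close>.\<close>

primrec euler ::
  "real \<Rightarrow> (nat \<Rightarrow> 'i \<Rightarrow> 'v::real_vector) \<Rightarrow> ('i \<Rightarrow> 'v) \<Rightarrow> (nat \<Rightarrow> 'i \<Rightarrow> ('i \<Rightarrow> 'v) \<Rightarrow> 'v) \<Rightarrow> nat \<Rightarrow> 'i \<Rightarrow> 'v" where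
  "euler h w x F 0 = x"
| "euler h w x F (Suc r) =
     (\<lambda>i. euler h w x F r i + h *\<^sub>R F r i (euler h w x F r) + w r i)"

text \<open>Causality: only the drifts of earlier steps matter. Hence resampling a division leaves
  the path before its time step unchanged, and the first \<open>k\<close> divisions determine the
  path up to time \<open>k * \<tau>\<close>.\<close>

lemma euler_cong: "(\<And>s. s < r \<Longrightarrow> F s = G s) \<Longrightarrow> euler h w x F r = euler h w x G r"
  by (induction r) auto


text \<open>Gronwall constant for resampling one division: two interactions of size at most
  \<open>B\<close> act as a source \<open>2 * B\<close>, and \<open>b\<close> contributes the growth
  rate \<Lambda>.\<close>

definition resample_const where "resample_const T B \<Lambda> = 2 * B * exp (\<Lambda> * T)"

text \<open>Collects the coefficients of the recursion for the mean square error. The terms with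
  \<open>resample_const\<close> come from the correlation with the current division,
  \<open>2 * T * \<Lambda>\<^sup>2\<close> and \<open>8 * B\<^sup>2\<close> from the square of one
  increment.\<close>

definition strong_const where
  "strong_const T B \<Lambda> =
    (12 * B * resample_const T B \<Lambda> + 8 * B\<^sup>2) * T
      * exp ((2 * \<Lambda> + 6 * B + 2 * T * \<Lambda>\<^sup>2 + 8 * B * T * resample_const T B \<Lambda>) * T)"

definition weak_const where
  "weak_const T B \<Lambda> =
    ((\<Lambda> + 4 * B) * strong_const T B \<Lambda> + 4 * B * resample_const T B \<Lambda>) * T * exp ((\<Lambda> + 2 * B) * T)"

text \<open>The noise increments \<open>w\<close> and the initial values are arbitrary but common to
  both schemes. A time step consists of \<open>q\<close> Euler steps, so Euler step \<open>r\<close>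
  belongs to time step \<open>r div q\<close>.\<close>

locale euler_pair = interacting_particles N n p A \<Lambda> b b' m K K'
  for N n p A \<Lambda> b b' m and K :: "nat \<Rightarrow> nat \<Rightarrow> (real ^ 'd) \<times> (real ^ 'd) \<Rightarrow> real ^ 'd" and K' +
  fixes T \<tau> h :: real and k q :: nat and w :: "nat \<Rightarrow> nat \<Rightarrow> real ^ 'd" and x\<^sub>0 :: "nat \<Rightarrow> real ^ 'd"
  assumes h: "h > 0" and \<tau>: "real q * h = \<tau>" and q: "q \<ge> 1" and k: "k \<ge> 1" and kT: "real k * \<tau> \<le> T"
begin

abbreviation "\<C> \<equiv> {..<k} \<rightarrow>\<^sub>E \<D>"
abbreviation "\<delta> \<equiv> resample_const T B \<Lambda>"

definition x where
  "x = euler h w x\<^sub>0 (\<lambda>_. particle_drift b m K I)"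

definition y where
  "y c = euler h w x\<^sub>0 (\<lambda>r i. particle_drift b m K (batch_of (c (r div q)) i) i)"

definition d where "d c r i = y c r i - x r i"

lemma \<tau>_bounds: "0 < \<tau>" "h \<le> \<tau>" "\<tau> \<le> T" "real (k * q) * h \<le> T" "0 < T"
proof -
  show "0 < \<tau>" "h \<le> \<tau>" using h q \<tau> by (auto simp: mult_le_cancel_right2)
  then have "1 * \<tau> \<le> real k * \<tau>" using k by (intro mult_right_mono) auto
  then show "\<tau> \<le> T" using kT by simp
  then show "0 < T" using \<open>0 < \<tau>\<close> by simp
  show "real (k * q) * h \<le> T" using kT \<tau> by (simp add: mult.assoc)
qed

lemma \<C>: "finite \<C>" "\<C> \<noteq> {}"
  using divisions \<D>_finite by (auto intro: finite_PiE simp: PiE_eq_empty_iff)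

lemma div_less: "r < k * q \<Longrightarrow> r div q < k"
  using q by (simp add: less_mult_imp_div_less)

lemma b_lipschitz: "norm (b u - b v) \<le> \<Lambda> * norm (u - v)"
  using b unfolding quadratic_approx_def by blast

lemma x_Suc: "i \<in> I \<Longrightarrow> x (Suc r) i = x r i + h *\<^sub>R (b (x r i) + interaction m K I i (x r)) + w r i"
  by (simp add: x_def particle_drift_eq)

lemma y_Suc:
  assumes "i \<in> I" "c (r div q) \<in> \<D>"
  shows "y c (Suc r) i = y c r i
    + h *\<^sub>R (b (y c r i) + interaction m K (batch_of (c (r div q)) i) i (y c r)) + w r i"
  using batch_of_division[OF assms(2,1)] by (simp add: y_def particle_drift_eq)

lemma d_0 [simp]: "d c 0 i = 0"
  by (simp add: d_def x_def y_def)

text \<open>The full interaction at the batch state is added and subtracted. This leaves a term that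
  is Lipschitz in \<open>d\<close> and a fluctuation whose two parts are taken at the same state,
  the form in which its mean can vanish.\<close>

lemma d_Suc:
  assumes "i \<in> I" "c \<in> \<C>" "r < k * q"
  shows "d c (Suc r) i = d c r i + h *\<^sub>R ((b (y c r i) - b (x r i))
    + (interaction m K I i (y c r) - interaction m K I i (x r)) + fluctuation (c (r div q)) i (y c r))"
proof -
  have "c (r div q) \<in> \<D>" using assms div_less by (auto simp: PiE_iff)
  then show ?thesis
    using assms(1) by (simp add: d_def x_Suc y_Suc fluctuation_def algebra_simps)
qed

text \<open>The paths coincide up to the start of time step \<open>l\<close>. During that step their
  interactions differ by at most \<open>2 * B\<close>, whatever the positions; this source acts for
  one time step only, which produces the factor \<tau>.\<close>

lemma y_resample:
  assumes c: "c \<in> \<C>" and D: "D \<in> \<D>" and l: "l < k" and r: "l * q \<le> r" "r \<le> Suc l * q" and i: "i \<in> I"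
  shows "norm (y (c(l := D)) r i - y c r i) \<le> \<delta> * \<tau>"
proof -
  let ?c = "c(l := D)"
  define a where "a s = norm (y ?c (l * q + s) i - y c (l * q + s) i)" for s
  have step: "a (Suc s) \<le> (1 + h * \<Lambda>) * a s + h * (2 * B)" if s: "s < q" for s
  proof -
    let ?r = "l * q + s"
    \<comment> \<open>All \<open>q\<close> Euler steps of the time step, including the one that ends
      at \<open>Suc l * q\<close>, still use division \<open>l\<close>.\<close>
    have div: "?r div q = l" using s by simp
    have cl: "c l \<in> \<D>" using c l by (auto simp: PiE_iff)
    let ?b = "b (y ?c ?r i) - b (y c ?r i)"
    let ?u = "interaction m K (batch_of D i) i (y ?c ?r)" and ?v = "interaction m K (batch_of (c l) i) i (y c ?r)"
    have "a (Suc s) = norm ((y ?c ?r i - y c ?r i) + h *\<^sub>R (?b + (?u - ?v)))"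
      using i D cl div by (simp add: a_def y_Suc algebra_simps)
    also have "\<dots> \<le> a s + h * norm (?b + (?u - ?v))"
      using h by (intro order_trans[OF norm_triangle_ineq]) (simp add: a_def)
    also have "norm (?b + (?u - ?v)) \<le> norm ?b + (norm ?u + norm ?v)"
      by (meson norm_triangle_ineq norm_triangle_ineq4 add_left_mono order_trans)
    also have "\<dots> \<le> \<Lambda> * a s + (B + B)"
      unfolding a_def using D cl i batch_of_division
      by (intro add_mono b_lipschitz norm_interaction_le) auto
    finally show ?thesis using h by (simp add: algebra_simps)
  qed
  have "y ?c (l * q) = y c (l * q)"
    unfolding y_def
  proof (rule euler_cong)
    fix s assume "s < l * q"
    then have "s div q \<noteq> l" by (metis less_mult_imp_div_less less_irrefl)
    then show "(\<lambda>i. particle_drift b m K (batch_of (?c (s div q)) i) i)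
      = (\<lambda>i. particle_drift b m K (batch_of (c (s div q)) i) i)" by simp
  qed
  then have "a 0 = 0" by (simp add: a_def)
  then have "a (r - l * q) \<le> 2 * B * \<tau> * exp (\<Lambda> * \<tau>)"
    using step h r \<Lambda>_nonneg B_nonneg \<tau> by (intro discrete_gronwall_le[of a h \<Lambda> "2 * B" q]) auto
  also have "\<dots> \<le> 2 * B * \<tau> * exp (\<Lambda> * T)"
    using B_nonneg \<tau>_bounds \<Lambda>_nonneg by (intro mult_left_mono) (auto intro: mult_left_mono)
  finally show ?thesis using r by (simp add: a_def resample_const_def algebra_simps)
qed

lemma \<delta>_nonneg: "0 \<le> \<delta>"
  using B_nonneg by (simp add: resample_const_def)

text \<open>Resampling the division of the current step makes it independent of the state, so that the
  fluctuation averages out, and moves the state by \<open>O(\<tau>)\<close> only.\<close>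

lemma norm_avg_fluctuation_le:
  assumes i: "i \<in> I" and r: "r < k * q"
  shows "norm (avg \<C> (\<lambda>c. fluctuation (c (r div q)) i (y c r))) \<le> 4 * B * (\<delta> * \<tau>)"
proof -
  define l where "l = r div q"
  have l: "l < k" "l * q \<le> r" "r \<le> Suc l * q"
    using r div_less q unfolding l_def by (auto simp: dividend_less_div_times less_imp_le)
  have "norm (avg \<C> (\<lambda>c. avg \<D> (\<lambda>D. fluctuation D i (y (c(l := D)) r)))) \<le> 4 * B * (\<delta> * \<tau>)"
  proof (rule norm_avg_le_const[OF \<C>])
    fix c assume c: "c \<in> \<C>"
    have "avg \<D> (\<lambda>D. fluctuation D i (y (c(l := D)) r))
        = avg \<D> (\<lambda>D. fluctuation D i (y (c(l := D)) r) - fluctuation D i (y c r))"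
      using avg_fluctuation[OF i] by (simp add: avg_diff)
    also have "norm \<dots> \<le> 4 * B * (\<delta> * \<tau>)"
      using i c l by (intro norm_avg_le_const[OF \<D>_finite divisions] norm_fluctuation_diff_le y_resample)
    finally show "norm (avg \<D> (\<lambda>D. fluctuation D i (y (c(l := D)) r))) \<le> 4 * B * (\<delta> * \<tau>)" .
  qed
  then show ?thesis
    using l(1) \<D>_finite divisions
    by (subst avg_PiE_resample[of l]) (auto simp: l_def)
qed

text \<open>The current division affects both factors. The change of \<open>d\<close> is paired with
  the bound \<open>2 * B\<close> of the fluctuation, and the change of the fluctuation with
  \<open>norm (d c r i)\<close>; the latter product is dominated by a square that Gronwall's
  inequality absorbs.\<close>

lemma avg_inner_fluctuation_le:
  assumes i: "i \<in> I" and r: "r < k * q"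
  shows "avg \<C> (\<lambda>c. d c r i \<bullet> fluctuation (c (r div q)) i (y c r))
    \<le> 6 * B * \<delta> * \<tau> + 4 * B * \<delta> * T * avg \<C> (\<lambda>c. (norm (d c r i))\<^sup>2)"
proof -
  define l where "l = r div q"
  have l: "l < k" "l * q \<le> r" "r \<le> Suc l * q"
    using r div_less q unfolding l_def by (auto simp: dividend_less_div_times less_imp_le)
  have "avg \<C> (\<lambda>c. d c r i \<bullet> fluctuation (c l) i (y c r))
      = avg \<C> (\<lambda>c. avg \<D> (\<lambda>D. d (c(l := D)) r i \<bullet> fluctuation D i (y (c(l := D)) r)))"
    using l(1) \<D>_finite divisions by (subst avg_PiE_resample[of l]) auto
  also have "\<dots> \<le> avg \<C> (\<lambda>c. 6 * B * \<delta> * \<tau> + 4 * B * \<delta> * T * (norm (d c r i))\<^sup>2)"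
  proof (rule avg_mono)
    fix c assume c: "c \<in> \<C>"
    \<comment> \<open>Neither \<open>d c r i\<close> nor \<open>y c r\<close> involves the new
      division \<open>D\<close>, so this term has mean zero and may be subtracted freely.\<close>
    have "avg \<D> (\<lambda>D. d c r i \<bullet> fluctuation D i (y c r)) = 0"
      using avg_linear[of "inner (d c r i)" \<D> "\<lambda>D. fluctuation D i (y c r)"] avg_fluctuation[OF i]
      by (simp add: bounded_linear.linear bounded_linear_inner_right)
    then have "avg \<D> (\<lambda>D. d (c(l := D)) r i \<bullet> fluctuation D i (y (c(l := D)) r))
      = avg \<D> (\<lambda>D. d (c(l := D)) r i \<bullet> fluctuation D i (y (c(l := D)) r) - d c r i \<bullet> fluctuation D i (y c r))"
      by (simp add: avg_diff)
    also have "\<dots> \<le> 6 * B * \<delta> * \<tau> + 4 * B * \<delta> * T * (norm (d c r i))\<^sup>2"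
    proof (rule avg_le_const[OF \<D>_finite divisions])
      fix D assume D: "D \<in> \<D>"
      let ?c = "c(l := D)"
      let ?f = "fluctuation D i"
      have near: "norm (y ?c r j - y c r j) \<le> \<delta> * \<tau>" if "j \<in> I" for j
        using y_resample[OF c D l that] .
      have "d ?c r i \<bullet> ?f (y ?c r) - d c r i \<bullet> ?f (y c r)
          = (y ?c r i - y c r i) \<bullet> ?f (y ?c r) + d c r i \<bullet> (?f (y ?c r) - ?f (y c r))"
        by (simp add: d_def algebra_simps)
      also have "\<dots> \<le> norm (y ?c r i - y c r i) * norm (?f (y ?c r)) + norm (d c r i) * norm (?f (y ?c r) - ?f (y c r))"
        by (intro add_mono norm_cauchy_schwarz)
      also have "\<dots> \<le> \<delta> * \<tau> * (2 * B) + norm (d c r i) * (4 * B * (\<delta> * \<tau>))"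
        using near i D \<delta>_nonneg \<tau>_bounds
        by (intro add_mono mult_mono norm_fluctuation_le norm_fluctuation_diff_le) auto
      also have "\<dots> \<le> \<delta> * \<tau> * (2 * B) + (1 + (norm (d c r i))\<^sup>2) * (4 * B * (\<delta> * \<tau>))"
      proof -
        \<comment> \<open>Splits the linear term: the constant joins the source of order \<tau>, the
          square joins the growth term.\<close>
        have "norm (d c r i) \<le> 1 + (norm (d c r i))\<^sup>2"
          using zero_le_power2[of "norm (d c r i) - 1"] norm_ge_zero[of "d c r i"]
          unfolding power2_diff power_one mult_1_right by linarith
        then show ?thesis using B_nonneg \<delta>_nonneg \<tau>_bounds by (intro add_left_mono mult_right_mono) auto
      qed
      also have "\<dots> = 6 * B * \<delta> * \<tau> + 4 * B * \<delta> * \<tau> * (norm (d c r i))\<^sup>2"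
        by (simp add: algebra_simps)
      \<comment> \<open>Only the factor in front of the square is enlarged to \<open>T\<close>: the
        growth rate loses its dependence on \<tau>, while the source keeps its factor
        \<tau>.\<close>
      also have "\<dots> \<le> 6 * B * \<delta> * \<tau> + 4 * B * \<delta> * T * (norm (d c r i))\<^sup>2"
        using B_nonneg \<delta>_nonneg \<tau>_bounds by (intro add_left_mono mult_right_mono mult_left_mono) auto
      finally show "d ?c r i \<bullet> ?f (y ?c r) - d c r i \<bullet> ?f (y c r) \<le> 6 * B * \<delta> * \<tau> + 4 * B * \<delta> * T * (norm (d c r i))\<^sup>2" .
    qed
    finally show "avg \<D> (\<lambda>D. d (c(l := D)) r i \<bullet> fluctuation D i (y (c(l := D)) r))
      \<le> 6 * B * \<delta> * \<tau> + 4 * B * \<delta> * T * (norm (d c r i))\<^sup>2" .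
  qed
  also have "\<dots> = 6 * B * \<delta> * \<tau> + 4 * B * \<delta> * T * avg \<C> (\<lambda>c. (norm (d c r i))\<^sup>2)"
    using \<C> by (simp add: avg_add avg_mult avg_const)
  finally show ?thesis by (simp add: l_def)
qed

end

section \<open>Error recursions for the Euler schemes\<close>

lemma norm_add_scaleR_square:
  fixes u v :: "'a::real_inner"
  shows "(norm (u + h *\<^sub>R v))\<^sup>2 = (norm u)\<^sup>2 + h * (2 * (u \<bullet> v)) + h * (h * (norm v)\<^sup>2)"
  unfolding power2_norm_eq_inner by (simp add: inner_add inner_commute algebra_simps)

context euler_pair
begin

text \<open>The fluctuation is kept as an inner product because it becomes small only after
  averaging over the divisions. In the term of second order in \<open>h\<close>, one factor
  \<open>h\<close> is bounded by \<open>T\<close> where it multiplies the square of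
  \<open>d\<close>, and by \<tau> where it multiplies a constant, so that the source is of order
  \<tau>.\<close>

lemma norm_d_square_Suc_le:
  assumes i: "i \<in> I" and c: "c \<in> \<C>" and r: "r < k * q"
  shows "(norm (d c (Suc r) i))\<^sup>2 \<le> (norm (d c r i))\<^sup>2
    + h * ((2 * \<Lambda> + 4 * B + 2 * T * \<Lambda>\<^sup>2) * (norm (d c r i))\<^sup>2
      + 2 * B * avg (I - {i}) (\<lambda>j. (norm (d c r j))\<^sup>2)
      + 2 * (d c r i \<bullet> fluctuation (c (r div q)) i (y c r)) + 8 * B\<^sup>2 * \<tau>)"
proof -
  let ?D = "c (r div q)"
  define u where "u = d c r i"
  define \<beta> where "\<beta> = b (y c r i) - b (x r i)"
  define \<iota> where "\<iota> = interaction m K I i (y c r) - interaction m K I i (x r)"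
  define \<xi> where "\<xi> = fluctuation ?D i (y c r)"
  define a where "a = avg (I - {i}) (\<lambda>j. (norm (d c r j))\<^sup>2)"
  have D: "?D \<in> \<D>" using c div_less[OF r] by (auto simp: PiE_iff)
  have \<beta>: "norm \<beta> \<le> \<Lambda> * norm u"
    unfolding \<beta>_def u_def d_def by (rule b_lipschitz)
  have "norm \<iota> \<le> B * (norm u + avg (I - {i}) (\<lambda>j. norm (d c r j)))"
    unfolding \<iota>_def u_def d_def using i I_minus_ne by (intro norm_interaction_diff_le) auto
  then have "norm u * norm \<iota> \<le> norm u * (B * (norm u + avg (I - {i}) (\<lambda>j. norm (d c r j))))"
    by (rule mult_left_mono) simp
  also have "\<dots> = B * avg (I - {i}) (\<lambda>j. (norm u)\<^sup>2 + norm u * norm (d c r j))"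
    by (simp only: avg_add avg_mult avg_const[OF finite_Diff[OF I_ne(2)] I_minus_ne])
      (simp only: power2_eq_square distrib_left mult.left_commute[of "norm u"])
  also have "\<dots> \<le> B * avg (I - {i}) (\<lambda>j. 2 * (norm u)\<^sup>2 + (norm (d c r j))\<^sup>2)"
  proof (intro mult_left_mono avg_mono B_nonneg)
    fix j
    have "norm u * norm (d c r j) \<le> (norm u)\<^sup>2 + (norm (d c r j))\<^sup>2"
      using sum_squares_bound[of "norm u" "norm (d c r j)"]
        mult_nonneg_nonneg[OF norm_ge_zero norm_ge_zero, of u "d c r j"] by linarith
    then show "(norm u)\<^sup>2 + norm u * norm (d c r j) \<le> 2 * (norm u)\<^sup>2 + (norm (d c r j))\<^sup>2" by simp
  qed
  also have "\<dots> = B * (2 * (norm u)\<^sup>2 + a)"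
    by (simp only: a_def avg_add avg_const[OF finite_Diff[OF I_ne(2)] I_minus_ne])
  finally have \<iota>: "u \<bullet> \<iota> \<le> B * (2 * (norm u)\<^sup>2 + a)"
    using norm_cauchy_schwarz[of u \<iota>] by linarith
  have "u \<bullet> \<beta> \<le> norm u * (\<Lambda> * norm u)"
    using norm_cauchy_schwarz[of u \<beta>] mult_left_mono[OF \<beta>, of "norm u"] by simp
  then have inner: "2 * (u \<bullet> (\<beta> + \<iota> + \<xi>)) \<le> (2 * \<Lambda> + 4 * B) * (norm u)\<^sup>2 + 2 * B * a + 2 * (u \<bullet> \<xi>)"
    using \<iota> by (simp add: inner_add_right power2_eq_square algebra_simps)
  \<comment> \<open>The full interaction at \<open>y c r\<close> cancels between \<iota> and \<xi>;
    one batch and one full interaction remain, bounded irrespective of \<open>d\<close>.\<close>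
  have "norm (\<iota> + \<xi>) \<le> norm (interaction m K (batch_of ?D i) i (y c r)) + norm (interaction m K I i (x r))"
    unfolding \<iota>_def \<xi>_def fluctuation_def by (simp add: norm_triangle_ineq4)
  also have "\<dots> \<le> B + B"
    using i I_minus_ne batch_of_division[OF D i] by (intro add_mono norm_interaction_le) auto
  finally have "norm (\<beta> + \<iota> + \<xi>) \<le> \<Lambda> * norm u + 2 * B"
    using \<beta> norm_triangle_ineq[of \<beta> "\<iota> + \<xi>"] by (simp add: add.assoc)
  then have "(norm (\<beta> + \<iota> + \<xi>))\<^sup>2 \<le> (\<Lambda> * norm u + 2 * B)\<^sup>2"
    by (rule power_mono) simp
  also have "\<dots> \<le> 2 * \<Lambda>\<^sup>2 * (norm u)\<^sup>2 + 8 * B\<^sup>2"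
    using zero_le_power2[of "\<Lambda> * norm u - 2 * B"] by (simp add: power2_eq_square algebra_simps)
  finally have "h * (norm (\<beta> + \<iota> + \<xi>))\<^sup>2 \<le> h * (2 * \<Lambda>\<^sup>2 * (norm u)\<^sup>2) + h * (8 * B\<^sup>2)"
    using h by (simp add: distrib_left[symmetric])
  also have "\<dots> \<le> T * (2 * \<Lambda>\<^sup>2 * (norm u)\<^sup>2) + \<tau> * (8 * B\<^sup>2)"
    using \<tau>_bounds by (intro add_mono mult_right_mono) auto
  finally have square: "h * (norm (\<beta> + \<iota> + \<xi>))\<^sup>2 \<le> T * (2 * \<Lambda>\<^sup>2 * (norm u)\<^sup>2) + \<tau> * (8 * B\<^sup>2)" .
  have "d c (Suc r) i = u + h *\<^sub>R (\<beta> + \<iota> + \<xi>)"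
    unfolding u_def \<beta>_def \<iota>_def \<xi>_def by (rule d_Suc[OF i c r])
  then have "(norm (d c (Suc r) i))\<^sup>2 = (norm u)\<^sup>2 + h * (2 * (u \<bullet> (\<beta> + \<iota> + \<xi>)) + h * (norm (\<beta> + \<iota> + \<xi>))\<^sup>2)"
    by (simp add: norm_add_scaleR_square distrib_left)
  also have "\<dots> \<le> (norm u)\<^sup>2 + h * ((2 * \<Lambda> + 4 * B + 2 * T * \<Lambda>\<^sup>2) * (norm u)\<^sup>2
      + 2 * B * a + 2 * (u \<bullet> \<xi>) + 8 * B\<^sup>2 * \<tau>)"
    using inner square h by (intro add_left_mono mult_left_mono) (auto simp: algebra_simps)
  finally show ?thesis by (simp add: u_def a_def \<xi>_def)
qed

definition strong_error where
  "strong_error r = avg I (\<lambda>i. avg \<C> (\<lambda>c. (norm (d c r i))\<^sup>2))"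

text \<open>Averaging over the particles turns the partner means into \<open>strong_error\<close>
  itself and closes the recursion. In the growth rate, \<open>6 * B\<close> joins
  \<open>4 * B\<close> from the particle's own error and \<open>2 * B\<close> from its
  partners.\<close>

lemma strong_error_le:
  assumes "r \<le> k * q"
  shows "strong_error r \<le> strong_const T B \<Lambda> * \<tau>"
proof -
  let ?u = "2 * \<Lambda> + 6 * B + 2 * T * \<Lambda>\<^sup>2 + 8 * B * T * \<delta>"
  let ?v = "(12 * B * \<delta> + 8 * B\<^sup>2) * \<tau>"
  have step: "strong_error (Suc r) \<le> (1 + h * ?u) * strong_error r + h * ?v" if r: "r < k * q" for r
  proof -
    define s where "s = (\<lambda>i. avg \<C> (\<lambda>c. (norm (d c r i))\<^sup>2))"
    let ?w = "2 * \<Lambda> + 4 * B + 2 * T * \<Lambda>\<^sup>2"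
    have "strong_error (Suc r) \<le> avg I (\<lambda>i. s i + h * (?w * s i + 2 * B * avg (I - {i}) s
        + 2 * (6 * B * \<delta> * \<tau> + 4 * B * \<delta> * T * s i) + 8 * B\<^sup>2 * \<tau>))"
      unfolding strong_error_def
    proof (rule avg_mono)
      fix i assume i: "i \<in> I"
      let ?f = "\<lambda>c. d c r i \<bullet> fluctuation (c (r div q)) i (y c r)"
      have "avg \<C> (\<lambda>c. (norm (d c (Suc r) i))\<^sup>2) \<le> avg \<C> (\<lambda>c. (norm (d c r i))\<^sup>2
        + h * (?w * (norm (d c r i))\<^sup>2 + 2 * B * avg (I - {i}) (\<lambda>j. (norm (d c r j))\<^sup>2)
          + 2 * ?f c + 8 * B\<^sup>2 * \<tau>))"
        by (intro avg_mono norm_d_square_Suc_le i r)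
      also have "\<dots> = s i + h * (?w * s i + 2 * B * avg (I - {i}) s + 2 * avg \<C> ?f + 8 * B\<^sup>2 * \<tau>)"
        unfolding s_def by (simp only: avg_add avg_mult avg_const[OF \<C>] avg_swap[of \<C> "I - {i}"])
      also have "\<dots> \<le> s i + h * (?w * s i + 2 * B * avg (I - {i}) s
          + 2 * (6 * B * \<delta> * \<tau> + 4 * B * \<delta> * T * s i) + 8 * B\<^sup>2 * \<tau>)"
        unfolding s_def using avg_inner_fluctuation_le[OF i r] h
        by (intro add_left_mono mult_left_mono add_mono order_refl) auto
      finally show "avg \<C> (\<lambda>c. (norm (d c (Suc r) i))\<^sup>2) \<le> s i + h * (?w * s i + 2 * B * avg (I - {i}) s
          + 2 * (6 * B * \<delta> * \<tau> + 4 * B * \<delta> * T * s i) + 8 * B\<^sup>2 * \<tau>)" .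
    qed
    also have "\<dots> = avg I s + h * (?w * avg I s + 2 * B * avg I s
        + 2 * (6 * B * \<delta> * \<tau> + 4 * B * \<delta> * T * avg I s) + 8 * B\<^sup>2 * \<tau>)"
      using I_ne N_ge_2 by (simp only: avg_add avg_mult avg_const[OF I_ne(2,1)] avg_avg_remove)
    also have "avg I s = strong_error r" by (simp add: s_def strong_error_def)
    finally show ?thesis by (simp add: algebra_simps)
  qed
  have "strong_error r \<le> ?v * T * exp (?u * T)"
  proof (rule discrete_gronwall_le[of _ h ?u ?v "k * q"])
    show "strong_error 0 \<le> 0" by (simp add: strong_error_def avg_def)
    show "0 \<le> ?u" "0 \<le> ?v" using B_nonneg \<Lambda>_nonneg \<delta>_nonneg \<tau>_bounds by auto
  qed (use step h assms \<tau>_bounds in auto)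
  then show ?thesis by (simp add: strong_const_def algebra_simps)
qed

text \<open>The norm stands outside the average over the divisions, to keep the cancellation, but
  inside the one over the particles, since weights and gradients of the test function differ between
  them.\<close>

definition mean_error where
  "mean_error r = avg I (\<lambda>i. norm (avg \<C> (\<lambda>c. d c r i)))"

text \<open>Along the deterministic path \<open>x\<close> the linearised drift commutes with the average over the
  divisions, so only quadratic terms and the averaged fluctuation contribute.\<close>

lemma mean_error_Suc_le:
  assumes r: "r < k * q"
  shows "mean_error (Suc r) \<le> (1 + h * (\<Lambda> + 2 * B)) * mean_error r
    + h * ((\<Lambda> + 4 * B) * strong_error r + 4 * B * (\<delta> * \<tau>))"
proof -
  define s where "s = (\<lambda>i. avg \<C> (\<lambda>c. (norm (d c r i))\<^sup>2))"
  define e where "e = (\<lambda>i. avg \<C> (\<lambda>c. d c r i))"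
  have "mean_error (Suc r) \<le> avg I (\<lambda>i. norm (e i) + h * (\<Lambda> * norm (e i)
      + B * (norm (e i) + avg (I - {i}) (\<lambda>j. norm (e j)))
      + (\<Lambda> * s i + 2 * B * (s i + avg (I - {i}) s)) + 4 * B * (\<delta> * \<tau>)))"
    unfolding mean_error_def
  proof (rule avg_mono)
    fix i assume i: "i \<in> I"
    define \<rho> where "\<rho> c = (b (y c r i) - b (x r i) - b' (x r i) (d c r i))
      + (interaction m K I i (y c r) - interaction m K I i (x r) - interaction' i (x r) (d c r))" for c
    let ?\<xi> = "avg \<C> (\<lambda>c. fluctuation (c (r div q)) i (y c r))"
    have b'_linear: "linear (b' (x r i))" using b unfolding quadratic_approx_def by blast
    have "avg \<C> (\<lambda>c. d c (Suc r) i) = avg \<C> (\<lambda>c. d c r i + h *\<^sub>R (b' (x r i) (d c r i)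
        + interaction' i (x r) (d c r) + \<rho> c + fluctuation (c (r div q)) i (y c r)))"
      using i r by (intro avg_cong refl) (simp add: d_Suc \<rho>_def algebra_simps)
    also have "\<dots> = e i + h *\<^sub>R (b' (x r i) (e i) + interaction' i (x r) e + avg \<C> \<rho> + ?\<xi>)"
      unfolding e_def avg_linear[OF b'_linear] interaction'_avg[OF i] by (simp only: avg_add avg_scaleR)
    finally have eq: "avg \<C> (\<lambda>c. d c (Suc r) i)
        = e i + h *\<^sub>R (b' (x r i) (e i) + interaction' i (x r) e + avg \<C> \<rho> + ?\<xi>)" .
    have "norm (\<rho> c) \<le> \<Lambda> * (norm (d c r i))\<^sup>2
        + 2 * B * ((norm (d c r i))\<^sup>2 + avg (I - {i}) (\<lambda>j. (norm (d c r j))\<^sup>2))" for c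
      unfolding \<rho>_def d_def
      by (intro norm_triangle_mono norm_interaction_taylor_le i)
        (use b in \<open>unfold quadratic_approx_def, blast\<close>)
    then have "norm (avg \<C> \<rho>) \<le> avg \<C> (\<lambda>c. \<Lambda> * (norm (d c r i))\<^sup>2
        + 2 * B * ((norm (d c r i))\<^sup>2 + avg (I - {i}) (\<lambda>j. (norm (d c r j))\<^sup>2)))"
      by (intro order_trans[OF norm_avg_le] avg_mono)
    also have "\<dots> = \<Lambda> * s i + 2 * B * (s i + avg (I - {i}) s)"
      unfolding s_def by (simp only: avg_add avg_mult avg_swap[of \<C> "I - {i}"])
    finally have \<rho>: "norm (avg \<C> \<rho>) \<le> \<Lambda> * s i + 2 * B * (s i + avg (I - {i}) s)" .
    have b'e: "norm (b' (x r i) (e i)) \<le> \<Lambda> * norm (e i)"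
      using b unfolding quadratic_approx_def by blast
    have "norm (b' (x r i) (e i) + interaction' i (x r) e + avg \<C> \<rho> + ?\<xi>) \<le> \<Lambda> * norm (e i)
        + B * (norm (e i) + avg (I - {i}) (\<lambda>j. norm (e j)))
        + (\<Lambda> * s i + 2 * B * (s i + avg (I - {i}) s)) + 4 * B * (\<delta> * \<tau>)"
      by (rule norm_triangle_mono[OF norm_triangle_mono[OF norm_triangle_mono[OF
            b'e norm_interaction'_le[OF i]] \<rho>] norm_avg_fluctuation_le[OF i r]])
    then have "norm (h *\<^sub>R (b' (x r i) (e i) + interaction' i (x r) e + avg \<C> \<rho> + ?\<xi>))
        \<le> h * (\<Lambda> * norm (e i)
        + B * (norm (e i) + avg (I - {i}) (\<lambda>j. norm (e j)))
        + (\<Lambda> * s i + 2 * B * (s i + avg (I - {i}) s)) + 4 * B * (\<delta> * \<tau>))"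
      using h by simp
    then show "norm (avg \<C> (\<lambda>c. d c (Suc r) i)) \<le> norm (e i) + h * (\<Lambda> * norm (e i)
        + B * (norm (e i) + avg (I - {i}) (\<lambda>j. norm (e j)))
        + (\<Lambda> * s i + 2 * B * (s i + avg (I - {i}) s)) + 4 * B * (\<delta> * \<tau>))"
      unfolding eq by (intro norm_triangle_mono order_refl)
  qed
  also have "\<dots> = avg I (\<lambda>i. norm (e i)) + h * (\<Lambda> * avg I (\<lambda>i. norm (e i))
      + B * (avg I (\<lambda>i. norm (e i)) + avg I (\<lambda>i. norm (e i)))
      + (\<Lambda> * avg I s + 2 * B * (avg I s + avg I s)) + 4 * B * (\<delta> * \<tau>))"
    using I_ne N_ge_2 by (simp only: avg_add avg_mult avg_const[OF I_ne(2,1)] avg_avg_remove)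
  also have "avg I s = strong_error r" by (simp add: s_def strong_error_def)
  also have "avg I (\<lambda>i. norm (e i)) = mean_error r" by (simp add: e_def mean_error_def)
  finally show ?thesis by (simp add: algebra_simps)
qed

text \<open>The quadratic remainders of the drift enter through \<open>strong_error\<close> without
  a square root. They are therefore of order \<tau>, although the same estimate controls
  \<open>d\<close> itself only to order one half.\<close>

lemma mean_error_le:
  assumes "r \<le> k * q"
  shows "mean_error r \<le> weak_const T B \<Lambda> * \<tau>"
proof -
  let ?s = "strong_const T B \<Lambda>"
  let ?v = "((\<Lambda> + 4 * B) * ?s + 4 * B * \<delta>) * \<tau>"
  have "mean_error r \<le> ?v * T * exp ((\<Lambda> + 2 * B) * T)"
  proof (rule discrete_gronwall_le[of _ h _ _ "k * q"])
    show "mean_error 0 \<le> 0" by (simp add: mean_error_def avg_def)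
    show "0 \<le> \<Lambda> + 2 * B" using B_nonneg \<Lambda>_nonneg by auto
    have "0 \<le> ?s"
      using B_nonneg \<delta>_nonneg \<tau>_bounds by (simp add: strong_const_def)
    then show "0 \<le> ?v" using B_nonneg \<Lambda>_nonneg \<delta>_nonneg \<tau>_bounds by auto
    fix s assume s: "s < k * q"
    have "(\<Lambda> + 4 * B) * strong_error s \<le> (\<Lambda> + 4 * B) * (?s * \<tau>)"
      using s B_nonneg \<Lambda>_nonneg by (intro mult_left_mono strong_error_le) auto
    then have "(\<Lambda> + 4 * B) * strong_error s + 4 * B * (\<delta> * \<tau>) \<le> ?v"
      by (simp add: algebra_simps)
    then have "h * ((\<Lambda> + 4 * B) * strong_error s + 4 * B * (\<delta> * \<tau>)) \<le> h * ?v"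
      using h by (intro mult_left_mono) auto
    then show "mean_error (Suc s) \<le> (1 + h * (\<Lambda> + 2 * B)) * mean_error s + h * ?v"
      using mean_error_Suc_le[OF s] by linarith
  qed (use h assms \<tau>_bounds in auto)
  then show ?thesis by (simp add: weak_const_def algebra_simps)
qed

text \<open>The expansion point \<open>x\<close> does not depend on the divisions, so the linear
  part sees only the mean of \<open>d\<close> and the remainder only the mean square. The absolute
  value stays inside the particle average so that bounded weights can be inserted later.\<close>

lemma discrete_weak_error_le:
  assumes \<phi>: "quadratic_approx \<Lambda> \<phi> \<phi>'"
  shows "avg I (\<lambda>i. \<bar>avg \<C> (\<lambda>c. \<phi> (y c (k * q) i)) - \<phi> (x (k * q) i)\<bar>)
    \<le> \<Lambda> * (weak_const T B \<Lambda> + strong_const T B \<Lambda>) * \<tau>"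
proof -
  let ?r = "k * q"
  have "avg I (\<lambda>i. \<bar>avg \<C> (\<lambda>c. \<phi> (y c ?r i)) - \<phi> (x ?r i)\<bar>)
    \<le> avg I (\<lambda>i. \<Lambda> * norm (avg \<C> (\<lambda>c. d c ?r i)) + \<Lambda> * avg \<C> (\<lambda>c. (norm (d c ?r i))\<^sup>2))"
  proof (rule avg_mono)
    fix i
    let ?\<rho> = "\<lambda>c. \<phi> (y c ?r i) - \<phi> (x ?r i) - \<phi>' (x ?r i) (d c ?r i)"
    have lin: "linear (\<phi>' (x ?r i))" using \<phi> unfolding quadratic_approx_def by blast
    have "avg \<C> (\<lambda>c. \<phi> (y c ?r i)) - \<phi> (x ?r i) = avg \<C> (\<lambda>c. \<phi> (y c ?r i) - \<phi> (x ?r i))"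
      using \<C> by (simp add: avg_diff avg_const)
    also have "\<dots> = \<phi>' (x ?r i) (avg \<C> (\<lambda>c. d c ?r i)) + avg \<C> ?\<rho>"
      unfolding avg_linear[OF lin] by (simp add: avg_add[symmetric])
    finally have "norm (avg \<C> (\<lambda>c. \<phi> (y c ?r i)) - \<phi> (x ?r i))
        = norm (\<phi>' (x ?r i) (avg \<C> (\<lambda>c. d c ?r i)) + avg \<C> ?\<rho>)" by (rule arg_cong)
    moreover have "norm (\<phi>' (x ?r i) (avg \<C> (\<lambda>c. d c ?r i))) \<le> \<Lambda> * norm (avg \<C> (\<lambda>c. d c ?r i))"
      using \<phi> unfolding quadratic_approx_def by metis
    moreover have "norm (avg \<C> ?\<rho>) \<le> avg \<C> (\<lambda>c. \<Lambda> * (norm (d c ?r i))\<^sup>2)"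
    proof (rule order_trans[OF norm_avg_le avg_mono])
      show "norm (?\<rho> c) \<le> \<Lambda> * (norm (d c ?r i))\<^sup>2" for c
        using \<phi> unfolding quadratic_approx_def d_def by metis
    qed
    ultimately have "norm (avg \<C> (\<lambda>c. \<phi> (y c ?r i)) - \<phi> (x ?r i))
        \<le> \<Lambda> * norm (avg \<C> (\<lambda>c. d c ?r i)) + avg \<C> (\<lambda>c. \<Lambda> * (norm (d c ?r i))\<^sup>2)"
      by (simp only: norm_triangle_mono)
    then show "\<bar>avg \<C> (\<lambda>c. \<phi> (y c ?r i)) - \<phi> (x ?r i)\<bar>
      \<le> \<Lambda> * norm (avg \<C> (\<lambda>c. d c ?r i)) + \<Lambda> * avg \<C> (\<lambda>c. (norm (d c ?r i))\<^sup>2)"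
      by (simp only: avg_mult real_norm_def)
  qed
  also have "\<dots> = \<Lambda> * mean_error ?r + \<Lambda> * strong_error ?r"
    by (simp add: mean_error_def strong_error_def avg_add avg_mult)
  also have "\<dots> \<le> \<Lambda> * (weak_const T B \<Lambda> * \<tau>) + \<Lambda> * (strong_const T B \<Lambda> * \<tau>)"
    using \<Lambda>_nonneg by (intro add_mono mult_left_mono mean_error_le strong_error_le) auto
  finally show ?thesis by (simp add: algebra_simps)
qed

end

section \<open>Convergence of the Euler schemes\<close>

text \<open>The batch equation holds on half-open intervals, as the division changes at the right
  end. Continuity carries it to the end point, where the last Euler step of a time step
  ends.\<close>

lemma continuous_on_eq_right_endpoint:
  fixes f g :: "real \<Rightarrow> 'v::t2_space"
  assumes "a < b" and cont: "continuous_on {a..b} f" "continuous_on {a..b} g"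
    and eq: "\<And>t. a \<le> t \<Longrightarrow> t < b \<Longrightarrow> f t = g t"
  shows "f b = g b"
proof -
  have "(f \<longlongrightarrow> f b) (at_left b)" "(g \<longlongrightarrow> g b) (at_left b)"
    using assms(1) cont by (auto simp: continuous_on_Icc_at_leftD)
  moreover have "eventually (\<lambda>t. f t = g t) (at_left b)"
    using eq assms(1) by (auto simp: eventually_at_left intro!: exI[of _ a])
  ultimately have "(g \<longlongrightarrow> f b) (at_left b)" "(g \<longlongrightarrow> g b) (at_left b)"
    by (simp_all add: tendsto_cong)
  then show ?thesis
    by (rule tendsto_unique[OF trivial_limit_at_left_real])
qed

lemma uniformly_continuous_on_finite_family:
  fixes Y :: "'a::metric_space \<Rightarrow> 'i \<Rightarrow> 'v::real_normed_vector"
  assumes "finite I" "compact S" and cont: "\<And>i. i \<in> I \<Longrightarrow> continuous_on S (\<lambda>t. Y t i)" and "\<epsilon> > 0"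
  obtains \<eta> where "\<eta> > 0"
    "\<And>s t i. s \<in> S \<Longrightarrow> t \<in> S \<Longrightarrow> dist s t < \<eta> \<Longrightarrow> i \<in> I \<Longrightarrow> norm (Y s i - Y t i) \<le> \<epsilon>"
proof -
  have "\<exists>\<eta>>0. \<forall>s\<in>S. \<forall>t\<in>S. dist s t < \<eta> \<longrightarrow> (\<forall>i\<in>I. norm (Y s i - Y t i) \<le> \<epsilon>)"
    using \<open>finite I\<close> cont
  proof (induction I)
    case empty
    show ?case by (intro exI[of _ 1]) auto
  next
    case (insert j I)
    then obtain \<eta>\<^sub>1 where \<eta>\<^sub>1: "\<eta>\<^sub>1 > 0"
      "\<forall>s\<in>S. \<forall>t\<in>S. dist s t < \<eta>\<^sub>1 \<longrightarrow> (\<forall>i\<in>I. norm (Y s i - Y t i) \<le> \<epsilon>)" by auto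
    have "uniformly_continuous_on S (\<lambda>t. Y t j)"
      using insert.prems \<open>compact S\<close> by (intro compact_uniformly_continuous) auto
    then obtain \<eta>\<^sub>2 where \<eta>\<^sub>2: "\<eta>\<^sub>2 > 0"
      "\<forall>t\<in>S. \<forall>s\<in>S. dist s t < \<eta>\<^sub>2 \<longrightarrow> dist (Y s j) (Y t j) < \<epsilon>"
      using \<open>\<epsilon> > 0\<close> unfolding uniformly_continuous_on_def by blast
    show ?case
    proof (intro exI[of _ "min \<eta>\<^sub>1 \<eta>\<^sub>2"] conjI ballI impI)
      fix s t i assume "s \<in> S" "t \<in> S" "dist s t < min \<eta>\<^sub>1 \<eta>\<^sub>2" "i \<in> insert j I"
      then show "norm (Y s i - Y t i) \<le> \<epsilon>"
        using \<eta>\<^sub>1(2) \<eta>\<^sub>2(2) by (cases "i = j") (force simp: dist_norm)+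
    qed (use \<eta>\<^sub>1 \<eta>\<^sub>2 in auto)
  qed
  then show ?thesis using that by blast
qed

text \<open>Closeness is measured coordinatewise on the finite set \<open>I\<close>, so no norm on
  the configurations is involved; a common modulus of continuity of the coordinates is
  enough.\<close>

lemma continuous_on_lipschitz_family:
  fixes Y :: "'a::metric_space \<Rightarrow> 'i \<Rightarrow> 'v::real_normed_vector" and g :: "('i \<Rightarrow> 'v) \<Rightarrow> 'u::real_normed_vector"
  assumes I: "finite I" and \<Gamma>: "\<Gamma> \<ge> 0" and S: "compact S"
    and Y_cont: "\<And>i. i \<in> I \<Longrightarrow> continuous_on S (\<lambda>t. Y t i)"
    and lipschitz: "\<And>u v \<delta>. (\<And>j. j \<in> I \<Longrightarrow> norm (u j - v j) \<le> \<delta>) \<Longrightarrow> norm (g u - g v) \<le> \<Gamma> * \<delta>"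
  shows "continuous_on S (\<lambda>s. g (Y s))"
  unfolding continuous_on_iff
proof (intro ballI allI impI)
  fix s and \<epsilon> :: real assume s: "s \<in> S" and \<epsilon>: "\<epsilon> > 0"
  \<comment> \<open>Using \<open>\<Gamma> + 1\<close> keeps the denominator positive when
    \<open>\<Gamma> = 0\<close>.\<close>
  have e: "\<epsilon> / (2 * (\<Gamma> + 1)) > 0" using \<epsilon> \<Gamma> by simp
  obtain \<eta> where "\<eta> > 0" and \<eta>: "\<And>s t i. s \<in> S \<Longrightarrow> t \<in> S \<Longrightarrow>
      dist s t < \<eta> \<Longrightarrow> i \<in> I \<Longrightarrow> norm (Y s i - Y t i) \<le> \<epsilon> / (2 * (\<Gamma> + 1))"
    using uniformly_continuous_on_finite_family[where Y = Y, OF I S Y_cont e] by blast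
  have "\<Gamma> * (\<epsilon> / (2 * (\<Gamma> + 1))) < \<epsilon>" using \<epsilon> \<Gamma> by (simp add: field_simps add_nonneg_pos)
  then have "dist (g (Y t)) (g (Y s)) < \<epsilon>" if "t \<in> S" "dist t s < \<eta>" for t
    using lipschitz[of "Y t" "Y s"] \<eta>[OF that(1) s that(2)]
    unfolding dist_norm by (meson order_le_less_trans)
  then show "\<exists>d>0. \<forall>x'\<in>S. dist x' s < d \<longrightarrow> dist (g (Y x')) (g (Y s)) < \<epsilon>"
    using \<open>\<eta> > 0\<close> by blast
qed

locale switched_equation =
  fixes I :: "'i set" and k :: nat and \<tau> \<Gamma> :: real
    and G :: "nat \<Rightarrow> 'i \<Rightarrow> ('i \<Rightarrow> 'v::euclidean_space) \<Rightarrow> 'v"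
    and Y U :: "real \<Rightarrow> 'i \<Rightarrow> 'v" and x\<^sub>0 :: "'i \<Rightarrow> 'v"
  assumes I: "finite I" "I \<noteq> {}" and \<tau>: "\<tau> > 0" and \<Gamma>: "\<Gamma> \<ge> 0"
    and lipschitz: "\<And>l i u v \<delta>. l < k \<Longrightarrow> i \<in> I \<Longrightarrow> (\<And>j. j \<in> I \<Longrightarrow> norm (u j - v j) \<le> \<delta>) \<Longrightarrow>
      norm (G l i u - G l i v) \<le> \<Gamma> * \<delta>"
    and Y_cont: "\<And>i. i \<in> I \<Longrightarrow> continuous_on {0..real k * \<tau>} (\<lambda>t. Y t i)"
    and U_cont: "\<And>i. i \<in> I \<Longrightarrow> continuous_on {0..real k * \<tau>} (\<lambda>t. U t i)"
    and Y_0: "\<And>i. i \<in> I \<Longrightarrow> Y 0 i = x\<^sub>0 i"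
    and Y_eq: "\<And>l i t. l < k \<Longrightarrow> i \<in> I \<Longrightarrow> real l * \<tau> \<le> t \<Longrightarrow> t < real (Suc l) * \<tau> \<Longrightarrow>
      Y t i = Y (real l * \<tau>) i + integral {real l * \<tau>..t} (\<lambda>s. G l i (Y s)) + (U t i - U (real l * \<tau>) i)"
begin

lemma block_subset: "l < k \<Longrightarrow> {real l * \<tau>..real (Suc l) * \<tau>} \<subseteq> {0..real k * \<tau>}"
  using \<tau> by (auto simp del: of_nat_Suc intro: order_trans mult_right_mono)

lemma drift_continuous:
  assumes "l < k" "i \<in> I"
  shows "continuous_on {0..real k * \<tau>} (\<lambda>s. G l i (Y s))"
  using I(1) \<Gamma> compact_Icc Y_cont lipschitz[OF assms]
  by (rule continuous_on_lipschitz_family)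

lemma Y_eq_closed:
  assumes l: "l < k" and i: "i \<in> I" and t: "real l * \<tau> \<le> t" "t \<le> real (Suc l) * \<tau>"
  shows "Y t i = Y (real l * \<tau>) i + integral {real l * \<tau>..t} (\<lambda>s. G l i (Y s)) + (U t i - U (real l * \<tau>) i)"
proof (cases "t < real (Suc l) * \<tau>")
  case True
  then show ?thesis using Y_eq[OF l i t(1)] by simp
next
  case False
  let ?a = "real l * \<tau>" and ?b = "real (Suc l) * \<tau>"
  have "Y ?b i = Y ?a i + integral {?a..?b} (\<lambda>s. G l i (Y s)) + (U ?b i - U ?a i)"
  proof (rule continuous_on_eq_right_endpoint[where a = ?a and f = "\<lambda>t. Y t i"
        and g = "\<lambda>t. Y ?a i + integral {?a..t} (\<lambda>s. G l i (Y s)) + (U t i - U ?a i)"])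
    show "?a < ?b" using \<tau> by simp
    show "continuous_on {?a..?b} (\<lambda>t. Y t i)"
      using continuous_on_subset[OF Y_cont block_subset] i l by blast
    show "continuous_on {?a..?b} (\<lambda>t. Y ?a i + integral {?a..t} (\<lambda>s. G l i (Y s)) + (U t i - U ?a i))"
      using l i
      by (intro continuous_intros indefinite_integral_continuous_1 integrable_continuous_real
          continuous_on_subset[OF drift_continuous block_subset] continuous_on_subset[OF U_cont block_subset])
  qed (rule Y_eq[OF l i])
  moreover have "t = ?b" using False t by linarith
  ultimately show ?thesis by (simp only:)
qed

lemma Y_increment:
  assumes l: "l < k" and i: "i \<in> I" and st: "real l * \<tau> \<le> s" "s \<le> t" "t \<le> real (Suc l) * \<tau>"
  shows "Y t i - Y s i = integral {s..t} (\<lambda>s. G l i (Y s)) + (U t i - U s i)"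
proof -
  have "{real l * \<tau>..t} \<subseteq> {0..real k * \<tau>}"
    using block_subset[OF l] st by auto
  then have "(\<lambda>s. G l i (Y s)) integrable_on {real l * \<tau>..t}"
    by (intro integrable_continuous_real continuous_on_subset[OF drift_continuous[OF l i]])
  then have combine: "integral {real l * \<tau>..t} (\<lambda>s. G l i (Y s))
      = integral {real l * \<tau>..s} (\<lambda>s. G l i (Y s)) + integral {s..t} (\<lambda>s. G l i (Y s))"
    using st by (intro Henstock_Kurzweil_Integration.integral_combine[symmetric])
  have t: "Y t i = Y (real l * \<tau>) i + integral {real l * \<tau>..t} (\<lambda>s. G l i (Y s)) + (U t i - U (real l * \<tau>) i)"
    and s: "Y s i = Y (real l * \<tau>) i + integral {real l * \<tau>..s} (\<lambda>s. G l i (Y s)) + (U s i - U (real l * \<tau>) i)"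
    using Y_eq_closed[OF l i, of t] Y_eq_closed[OF l i, of s] st by linarith+
  show ?thesis
    by (subst t, subst s, subst combine) simp
qed

text \<open>The exact increments of \<open>U\<close> are inserted, so only the drift is discretised
  and the forcing cancels from the error.\<close>

definition euler_path where
  "euler_path q = euler (\<tau> / real q)
     (\<lambda>r i. U (real (Suc r) * (\<tau> / real q)) i - U (real r * (\<tau> / real q)) i) x\<^sub>0 (\<lambda>r. G (r div q))"

text \<open>Freezing the drift at the left end of each Euler step costs at most
  \<open>\<Gamma> * \<epsilon>\<close> per unit time, where \<epsilon> bounds the oscillation of the
  exact path over one step. The path is merely continuous, so this yields convergence without a
  rate, which suffices.\<close>

lemma euler_path_error:
  assumes q: "q \<ge> 1" and \<epsilon>: "\<epsilon> \<ge> 0"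
    and modulus: "\<And>s t i. s \<in> {0..real k * \<tau>} \<Longrightarrow> t \<in> {0..real k * \<tau>} \<Longrightarrow> dist s t \<le> \<tau> / real q \<Longrightarrow>
      i \<in> I \<Longrightarrow> norm (Y s i - Y t i) \<le> \<epsilon>"
    and i: "i \<in> I"
  shows "norm (Y (real k * \<tau>) i - euler_path q (k * q) i)
    \<le> \<Gamma> * \<epsilon> * (real k * \<tau>) * exp (\<Gamma> * (real k * \<tau>))"
proof -
  define h where "h = \<tau> / real q"
  have h: "h > 0" "real q * h = \<tau>" using q \<tau> by (auto simp: h_def)
  define Z where "Z = euler_path q"
  \<comment> \<open>A maximum over the particles is adequate here: the limit in \<open>q\<close> is
    taken for fixed \<open>N\<close>.\<close>
  define a where "a r = Max ((\<lambda>i. norm (Y (real r * h) i - Z r i)) ` I)" for r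
  have a_ge: "norm (Y (real r * h) j - Z r j) \<le> a r" if "j \<in> I" for r j
    unfolding a_def using I that by (intro Max_ge) auto
  have step: "a (Suc r) \<le> (1 + h * \<Gamma>) * a r + h * (\<Gamma> * \<epsilon>)" if r: "r < k * q" for r
  proof -
    define l where "l = r div q"
    have l: "l < k" using r q by (simp add: l_def less_mult_imp_div_less)
    \<comment> \<open>Each time step contains exactly \<open>q\<close> Euler steps, so no Euler step
      crosses a change of the drift.\<close>
    have "l * q \<le> r" "Suc r \<le> Suc l * q"
      using q unfolding l_def by (auto simp: dividend_less_div_times Suc_leI)
    then have "real (l * q) * h \<le> real r * h" "real (Suc r) * h \<le> real (Suc l * q) * h"
      using h by (intro mult_right_mono of_nat_mono; simp)+
    then have block: "real l * \<tau> \<le> real r * h" "real (Suc r) * h \<le> real (Suc l) * \<tau>"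
      using h(2) by (simp_all only: of_nat_mult mult.assoc)
    let ?s = "real r * h" and ?t = "real (Suc r) * h"
    have st: "?s \<le> ?t" "?t - ?s = h" using h by (auto simp: algebra_simps)
    have sub: "{?s..?t} \<subseteq> {0..real k * \<tau>}"
      using block block_subset[OF l] by auto
    show ?thesis unfolding a_def[of "Suc r"]
    proof (rule Max.boundedI)
      fix z assume "z \<in> (\<lambda>i. norm (Y ?t i - Z (Suc r) i)) ` I"
      then obtain j where j: "j \<in> I" and z: "z = norm (Y ?t j - Z (Suc r) j)" by blast
      let ?g = "\<lambda>s. G l j (Y s) - G l j (Y ?s)"
      have cont: "continuous_on {?s..?t} (\<lambda>s. G l j (Y s))"
        using continuous_on_subset[OF drift_continuous[OF l j] sub] .
      have "integral {?s..?t} (\<lambda>s. G l j (Y s)) = integral {?s..?t} (\<lambda>_. G l j (Y ?s)) + integral {?s..?t} ?g"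
        using integrable_continuous_real[OF cont]
        by (simp add: Henstock_Kurzweil_Integration.integral_diff integrable_const_ivl)
      then have int: "integral {?s..?t} (\<lambda>s. G l j (Y s)) = h *\<^sub>R G l j (Y ?s) + integral {?s..?t} ?g"
        using st by simp
      have Z: "Z (Suc r) j = Z r j + h *\<^sub>R G l j (Z r) + (U ?t j - U ?s j)"
        by (simp add: Z_def euler_path_def h_def l_def)
      have Y: "Y ?t j = Y ?s j + (h *\<^sub>R G l j (Y ?s) + integral {?s..?t} ?g + (U ?t j - U ?s j))"
        using Y_increment[OF l j block(1) st(1) block(2)] unfolding int
        by (simp only: diff_eq_eq add.commute)
      have "Y ?t j - Z (Suc r) j = (Y ?s j - Z r j) + h *\<^sub>R (G l j (Y ?s) - G l j (Z r)) + integral {?s..?t} ?g"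
        by (subst Y, subst Z) (simp add: scaleR_diff_right)
      moreover have "norm (G l j (Y ?s) - G l j (Z r)) \<le> \<Gamma> * a r"
        using lipschitz[OF l j] a_ge by blast
      then have "norm (h *\<^sub>R (G l j (Y ?s) - G l j (Z r))) \<le> h * (\<Gamma> * a r)" using h by simp
      moreover have "norm (integral {?s..?t} ?g) \<le> \<Gamma> * \<epsilon> * (?t - ?s)"
      proof (rule integral_bound[OF st(1)])
        show "continuous_on {?s..?t} ?g" using cont by (intro continuous_intros)
        fix s assume s: "s \<in> {?s..?t}"
        moreover have "?s \<in> {?s..?t}" using st(1) by simp
        ultimately have "s \<in> {0..real k * \<tau>}" "?s \<in> {0..real k * \<tau>}" using sub by blast+
        moreover have "dist s ?s \<le> \<tau> / real q" using s st by (auto simp: dist_real_def h_def)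
        ultimately show "norm (?g s) \<le> \<Gamma> * \<epsilon>"
          using lipschitz[OF l j] modulus by blast
      qed
      ultimately have "z \<le> a r + h * (\<Gamma> * a r) + \<Gamma> * \<epsilon> * (?t - ?s)"
        unfolding z by (simp only: norm_triangle_mono a_ge[OF j])
      then show "z \<le> (1 + h * \<Gamma>) * a r + h * (\<Gamma> * \<epsilon>)" unfolding st(2) by (simp add: algebra_simps)
    qed (use I in auto)
  qed
  have "a (k * q) \<le> \<Gamma> * \<epsilon> * (real k * \<tau>) * exp (\<Gamma> * (real k * \<tau>))"
  proof (rule discrete_gronwall_le[of a h \<Gamma> "\<Gamma> * \<epsilon>" "k * q"])
    have "\<forall>j\<in>I. norm (Y (real 0 * h) j - Z 0 j) = 0"
      using Y_0 by (simp add: Z_def euler_path_def)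
    then have "(\<lambda>j. norm (Y (real 0 * h) j - Z 0 j)) ` I = {0}" using I(2) by force
    then show "a 0 \<le> 0" unfolding a_def by simp
    show "real (k * q) * h \<le> real k * \<tau>" using h by (simp add: mult.assoc)
  qed (use step h \<Gamma> \<epsilon> in auto)
  moreover have "real (k * q) * h = real k * \<tau>" using h by (simp add: mult.assoc)
  then have "norm (Y (real k * \<tau>) i - Z (k * q) i) \<le> a (k * q)"
    using a_ge[OF i, of "k * q"] by (simp only:)
  ultimately show ?thesis unfolding Z_def by (rule order_trans[rotated])
qed

text \<open>Uniform continuity on the compact interval makes the oscillation over one Euler step
  arbitrarily small. The shift to \<open>Suc q\<close> keeps the number of Euler steps per time step
  positive.\<close>

lemma euler_path_tendsto:
  assumes i: "i \<in> I"
  shows "(\<lambda>q. euler_path (Suc q) (k * Suc q) i) \<longlonglongrightarrow> Y (real k * \<tau>) i"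
proof (rule LIMSEQ_I)
  fix \<epsilon>' :: real assume \<epsilon>': "\<epsilon>' > 0"
  let ?c = "\<Gamma> * (real k * \<tau>) * exp (\<Gamma> * (real k * \<tau>))"
  have c: "?c \<ge> 0" using \<Gamma> \<tau> by simp
  define \<epsilon> where "\<epsilon> = \<epsilon>' / (?c + 1)"
  have \<epsilon>: "\<epsilon> > 0" using c \<epsilon>' by (simp add: \<epsilon>_def add_nonneg_pos)
  have "?c * \<epsilon> < (?c + 1) * \<epsilon>" using \<epsilon> by (intro mult_strict_right_mono) auto
  also have "\<dots> = \<epsilon>'" using c by (simp add: \<epsilon>_def add_nonneg_eq_0_iff)
  finally have lt: "?c * \<epsilon> < \<epsilon>'" .
  obtain \<eta> where "\<eta> > 0" and \<eta>: "\<And>s t i. s \<in> {0..real k * \<tau>} \<Longrightarrow> t \<in> {0..real k * \<tau>} \<Longrightarrow>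
      dist s t < \<eta> \<Longrightarrow> i \<in> I \<Longrightarrow> norm (Y s i - Y t i) \<le> \<epsilon>"
    using uniformly_continuous_on_finite_family[where Y = Y, OF I(1) compact_Icc Y_cont \<epsilon>] by blast
  have "(\<lambda>q. \<tau> * inverse (real (Suc q))) \<longlonglongrightarrow> \<tau> * 0"
    by (intro tendsto_intros LIMSEQ_inverse_real_of_nat)
  then have "eventually (\<lambda>q. \<tau> / real (Suc q) < \<eta>) sequentially"
    using \<open>\<eta> > 0\<close> order_tendstoD(2) by (fastforce simp: field_simps)
  then obtain q\<^sub>0 where q\<^sub>0: "\<And>q. q \<ge> q\<^sub>0 \<Longrightarrow> \<tau> / real (Suc q) < \<eta>"
    unfolding eventually_sequentially by blast
  have "norm (euler_path (Suc q) (k * Suc q) i - Y (real k * \<tau>) i) < \<epsilon>'" if "q \<ge> q\<^sub>0" for q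
  proof -
    have "norm (Y (real k * \<tau>) i - euler_path (Suc q) (k * Suc q) i)
        \<le> \<Gamma> * \<epsilon> * (real k * \<tau>) * exp (\<Gamma> * (real k * \<tau>))"
      using \<epsilon> q\<^sub>0[OF that] by (intro euler_path_error \<eta> i) auto
    also have "\<dots> = ?c * \<epsilon>" by (simp only: ac_simps)
    finally show ?thesis using lt unfolding norm_minus_commute[of "Y (real k * \<tau>) i"]
      by (rule order_le_less_trans)
  qed
  then show "\<exists>q\<^sub>0. \<forall>q\<ge>q\<^sub>0. norm (euler_path (Suc q) (k * Suc q) i - Y (real k * \<tau>) i) < \<epsilon>'" by blast
qed

end

section \<open>Independence of the divisions\<close>

text \<open>Independence is available for sigma-algebras. Preimages under \<open>f\<close> lie in
  \<open>\<A>\<close> and those under the indicator of \<open>F\<close> in \<open>\<B>\<close>,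
  which makes the two variables independent; boundedness makes them integrable.\<close>

lemma (in prob_space) expectation_indicator_mult:
  fixes f :: "'a \<Rightarrow> real"
  assumes indep: "indep_set \<A> \<B>" and \<A>: "sigma_algebra (space M) \<A>" and \<B>: "sigma_algebra (space M) \<B>"
    and f: "\<And>A. A \<in> sets borel \<Longrightarrow> f -` A \<inter> space M \<in> \<A>" and F: "F \<in> \<B>" and bound: "\<And>\<omega>. \<bar>f \<omega>\<bar> \<le> C"
  shows "expectation (\<lambda>\<omega>. indicator F \<omega> * f \<omega>) = prob F * expectation f"
proof -
  have events: "\<A> \<subseteq> events" "\<B> \<subseteq> events"
    using indep indep_setD_ev1 indep_setD_ev2 by auto
  have F_space: "F \<subseteq> space M" using F events sets.sets_into_space by blast
  have f_meas: "f \<in> borel_measurable M"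
    using f events by (intro measurableI) auto
  have F_meas: "(indicator F :: 'a \<Rightarrow> real) \<in> borel_measurable M"
    using F events by auto
  have "indep_var borel f borel (indicator F :: 'a \<Rightarrow> real)"
    unfolding indep_var_eq
  proof (intro conjI f_meas F_meas)
    have 1: "sigma_sets (space M) {f -` A \<inter> space M |A. A \<in> sets borel} \<subseteq> \<A>"
      using f by (intro sigma_algebra.sigma_sets_subset[OF \<A>]) auto
    have "indicator F -` A \<inter> space M \<in> \<B>" for A :: "real set"
    proof -
      interpret \<B>: sigma_algebra "space M" \<B> by (rule \<B>)
      have "indicator F -` A \<inter> space M = (if 1 \<in> A then F else {}) \<union> (if 0 \<in> A then space M - F else {})"
        using F_space by (auto simp: indicator_def of_bool_def split: if_splits)
      then show ?thesis using F by auto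
    qed
    then have 2: "sigma_sets (space M) {indicator F -` A \<inter> space M |A. A \<in> sets (borel :: real measure)} \<subseteq> \<B>"
      by (intro sigma_algebra.sigma_sets_subset[OF \<B>]) auto
    show "indep_set (sigma_sets (space M) {f -` A \<inter> space M |A. A \<in> sets borel})
      (sigma_sets (space M) {indicator F -` A \<inter> space M |A. A \<in> sets (borel :: real measure)})"
      using indep 1 2 unfolding indep_sets2_eq by blast
  qed
  then have "expectation (\<lambda>\<omega>. f \<omega> * indicator F \<omega>) = expectation f * expectation (indicator F)"
  proof (rule indep_var_lebesgue_integral)
    show "integrable M f" using f_meas bound by (intro integrable_const_bound[of _ C]) auto
    show "integrable M (indicator F :: 'a \<Rightarrow> real)"
      using F_meas by (intro integrable_const_bound[of _ 1]) auto
  qed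
  then show ?thesis
    using F events by (auto simp: mult.commute)
qed

lemma sigma_algebra_vimage_algebra: "sigma_algebra X (sets (vimage_algebra X f M))"
  using sets.sigma_algebra_axioms[of "vimage_algebra X f M"] by simp

locale rbm_data =
  fixes n p :: nat and P :: "'w measure" and X0 :: "nat \<Rightarrow> 'w \<Rightarrow> real ^ 'd"
    and W :: "nat \<Rightarrow> real \<Rightarrow> 'w \<Rightarrow> real ^ 'd" and Cs :: "nat \<Rightarrow> 'w \<Rightarrow> nat set set"
  assumes randomness: "rbm_randomness n p P X0 W Cs"
begin

sublocale prob_space P
  using randomness by (simp add: rbm_randomness_def)

abbreviation "src \<equiv> source_events P X0 W Cs"
abbreviation "\<D> \<equiv> batch_divisions n p"

definition data_sources :: "source set" where
  "data_sources = Initial ` {1..n * p} \<union> Noise ` {1..n * p}"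

text \<open>Carries everything that gets frozen. It is a measure rather than a family of sets so
  that \<open>borel_measurable\<close> can refer to it.\<close>

definition data_algebra :: "'w measure" where
  "data_algebra = sigma (space P) (\<Union>s\<in>data_sources. src s)"

lemma src_sigma_algebra: "sigma_algebra (space P) (src s)"
  by (cases s) (simp_all add: sigma_algebra_vimage_algebra)

lemma src_Pow: "src s \<subseteq> Pow (space P)"
  using src_sigma_algebra[of s] by (simp add: sigma_algebra_iff2)

lemma sets_data_algebra: "sets data_algebra = sigma_sets (space P) (\<Union>s\<in>data_sources. src s)"
  unfolding data_algebra_def using src_Pow by (intro sets_measure_of) blast

lemma space_data_algebra [simp]: "space data_algebra = space P"
  unfolding data_algebra_def using src_Pow by (intro space_measure_of) blast

lemma src_subset_data_algebra: "s \<in> data_sources \<Longrightarrow> src s \<subseteq> sets data_algebra"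
  unfolding sets_data_algebra by blast

lemma X0_measurable: "i \<in> {1..n * p} \<Longrightarrow> X0 i \<in> borel_measurable data_algebra"
  using src_subset_data_algebra[of "Initial i"]
  by (intro measurableI) (auto simp: data_sources_def intro!: in_vimage_algebra)

text \<open>The noise source is generated by the whole path on \<open>{0..}\<close>; a single time
  is recovered by a coordinate projection.\<close>

lemma W_measurable:
  assumes i: "i \<in> {1..n * p}" and t: "t \<ge> 0"
  shows "W i t \<in> borel_measurable data_algebra"
proof -
  let ?w = "\<lambda>\<omega>. \<lambda>t\<in>{0..}. W i t \<omega>"
  have "?w \<in> measurable data_algebra (Pi\<^sub>M {0..} (\<lambda>_. borel))"
    using src_subset_data_algebra[of "Noise i"] i
    by (intro measurableI) (auto simp: data_sources_def space_PiM intro!: in_vimage_algebra)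
  from measurable_compose[OF this measurable_component_singleton[of t]]
  show ?thesis using t by simp
qed

lemma indep_src: "indep_sets src (data_sources \<union> range Division)"
  using randomness unfolding rbm_randomness_def data_sources_def by simp

lemma data_algebra_events: "sets data_algebra \<subseteq> events"
proof -
  have "src s \<subseteq> events" if "s \<in> data_sources" for s
    using indep_src that unfolding indep_sets_def by blast
  then show ?thesis
    unfolding sets_data_algebra by (intro sets.sigma_sets_subset) blast
qed

lemma data_algebra_measurable: "f \<in> measurable data_algebra M \<Longrightarrow> f \<in> measurable P M"
  using data_algebra_events by (auto simp: measurable_def)

definition division_events :: "'w set set" where
  "division_events = sigma_sets (space P) (\<Union>s\<in>range Division. src s)"

text \<open>Joint independence is grouped into two blocks of sources. Their index sets are disjoint
  because the constructors differ, and each source is a sigma-algebra, hence stable under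
  intersection.\<close>

lemma indep_divisions: "indep_set (sets data_algebra) division_events"
proof -
  let ?I = "case_bool data_sources (range Division)"
  have "indep_sets (\<lambda>j. sigma_sets (space P) (\<Union>i\<in>?I j. src i)) UNIV"
  proof (rule indep_sets_collect_sigma)
    show "indep_sets src (\<Union>j\<in>UNIV. ?I j)"
      using indep_src by (simp add: UNIV_bool Un_commute)
    show "Int_stable (src i)" for i
      by (rule algebra.Int_stable[OF sigma_algebra.axioms(1)[OF src_sigma_algebra]])
    show "disjoint_family_on ?I UNIV"
      by (auto simp: disjoint_family_on_def data_sources_def split: bool.splits)
  qed
  moreover have "(\<lambda>j. sigma_sets (space P) (\<Union>i\<in>?I j. src i)) = case_bool (sets data_algebra) division_events"
    by (auto simp: fun_eq_iff sets_data_algebra division_events_def split: bool.splits)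
  ultimately show ?thesis unfolding indep_set_def by simp
qed

lemma division_sigma_algebra: "sigma_algebra (space P) division_events"
  unfolding division_events_def using src_Pow by (intro sigma_algebra_sigma_sets) blast

section \<open>Uniform law of the division path\<close>

lemma Cs_in_\<D>: "\<omega> \<in> space P \<Longrightarrow> Cs l \<omega> \<in> \<D>"
  using randomness measurable_space[of "Cs l" P "count_space \<D>"]
  unfolding rbm_randomness_def by simp

lemma \<D>_nonempty: "\<D> \<noteq> {}"
  using not_empty Cs_in_\<D> by blast

definition division_path :: "nat \<Rightarrow> (nat \<Rightarrow> nat set set) \<Rightarrow> 'w set" where
  "division_path k c = {\<omega> \<in> space P. \<forall>l\<in>{..<k}. Cs l \<omega> = c l}"

lemma Cs_eq_in_src: "{\<omega> \<in> space P. Cs l \<omega> = D} \<in> src (Division l)"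
proof -
  have "Cs l -` {D} \<inter> space P \<in> src (Division l)"
    by (simp add: in_vimage_algebra)
  moreover have "Cs l -` {D} \<inter> space P = {\<omega> \<in> space P. Cs l \<omega> = D}" by auto
  ultimately show ?thesis by simp
qed

lemma division_path_in: "division_path k c \<in> division_events"
proof -
  interpret sigma_algebra "space P" division_events by (rule division_sigma_algebra)
  show ?thesis unfolding division_path_def
    by (intro sets_Collect_finite_All finite_lessThan)
      (unfold division_events_def, blast intro: sigma_sets.Basic Cs_eq_in_src)
qed

lemma prob_Cs:
  assumes "D \<in> \<D>"
  shows "prob {\<omega> \<in> space P. Cs l \<omega> = D} = 1 / real (card \<D>)"
proof -
  have meas: "Cs l \<in> measurable P (count_space \<D>)"
    and distr: "distr P (count_space \<D>) (Cs l) = uniform_count_measure \<D>"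
    using randomness unfolding rbm_randomness_def by blast+
  have "prob (Cs l -` {D} \<inter> space P) = measure (distr P (count_space \<D>) (Cs l)) {D}"
    using meas assms by (simp add: measure_distr)
  also have "\<dots> = 1 / real (card \<D>)"
    unfolding distr using assms by (simp add: measure_uniform_count_measure finite_batch_divisions)
  finally show ?thesis
    by (simp add: vimage_def Int_def conj_commute)
qed

lemma prob_division_path:
  assumes c: "c \<in> {..<k} \<rightarrow>\<^sub>E \<D>"
  shows "prob (division_path k c) = 1 / real (card ({..<k} \<rightarrow>\<^sub>E \<D>))"
proof (cases "k = 0")
  \<comment> \<open>The event is the whole space; the product rule for independent events asks for a
    nonempty index set.\<close>
  case True
  then show ?thesis by (simp add: division_path_def prob_space)
next
  case False
  \<comment> \<open>Independence is indexed by sources, hence the detour; the default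
    \<open>{}\<close> concerns sources other than divisions, which do not occur in the
    product.\<close>
  define A where "A s = (case s of Division l \<Rightarrow> {\<omega> \<in> space P. Cs l \<omega> = c l} | _ \<Rightarrow> {})" for s
  have "prob (\<Inter>s\<in>Division ` {..<k}. A s) = (\<Prod>s\<in>Division ` {..<k}. prob (A s))"
    using False Cs_eq_in_src by (intro indep_setsD[OF indep_src]) (auto simp: A_def)
  also have "(\<Inter>s\<in>Division ` {..<k}. A s) = division_path k c"
    using False by (auto simp: A_def division_path_def)
  also have "(\<Prod>s\<in>Division ` {..<k}. prob (A s)) = (\<Prod>l<k. prob {\<omega> \<in> space P. Cs l \<omega> = c l})"
    by (simp add: prod.reindex inj_on_def A_def)
  also have "\<dots> = (1 / real (card \<D>)) ^ k"
    using c by (simp add: prob_Cs PiE_iff)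
  also have "\<dots> = 1 / real (card ({..<k} \<rightarrow>\<^sub>E \<D>))"
    by (simp add: card_PiE power_one_over)
  finally show ?thesis .
qed

text \<open>Conditioning on the divisions without conditional expectations: the expectation splits
  over the finitely many division paths, independence factors each piece, and all paths are equally
  likely. \<open>restrict\<close> puts the random sequence into the extensional function
  set.\<close>

lemma resample_divisions:
  fixes g :: "(nat \<Rightarrow> nat set set) \<Rightarrow> 'w \<Rightarrow> real" and k :: nat
  defines "\<C> \<equiv> {..<k} \<rightarrow>\<^sub>E \<D>"
  assumes g: "\<And>c. c \<in> \<C> \<Longrightarrow> g c \<in> borel_measurable data_algebra" and bound: "\<And>c \<omega>. \<bar>g c \<omega>\<bar> \<le> C"
  shows "(\<lambda>\<omega>. g (restrict (\<lambda>l. Cs l \<omega>) {..<k}) \<omega>) \<in> borel_measurable P" (is "?f \<in> _")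
    and "expectation (\<lambda>\<omega>. g (restrict (\<lambda>l. Cs l \<omega>) {..<k}) \<omega>) = expectation (\<lambda>\<omega>. avg \<C> (\<lambda>c. g c \<omega>))"
proof -
  have fin: "finite \<C>" unfolding \<C>_def using finite_batch_divisions by (intro finite_PiE) auto
  have g_meas: "g c \<in> borel_measurable P" if "c \<in> \<C>" for c
    using g[OF that] by (rule data_algebra_measurable)
  have path_event: "division_path k c \<in> events" for c
    using indep_setD_ev2[OF indep_divisions] division_path_in by blast
  have f_eq: "?f \<omega> = (\<Sum>c\<in>\<C>. indicator (division_path k c) \<omega> * g c \<omega>)" if \<omega>: "\<omega> \<in> space P" for \<omega>
  proof -
    let ?c = "restrict (\<lambda>l. Cs l \<omega>) {..<k}"
    have "indicator (division_path k c) \<omega> * g c \<omega> = (if c = ?c then g ?c \<omega> else 0)" if "c \<in> \<C>" for c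
    proof (cases "c = ?c")
      case True
      then show ?thesis using \<omega> by (simp add: division_path_def)
    next
      case False
      have "c = ?c" if "\<omega> \<in> division_path k c"
        using \<open>c \<in> \<C>\<close> that
        by (intro extensionalityI[of _ "{..<k}"]) (simp_all add: division_path_def \<C>_def PiE_iff)
      then have "indicator (division_path k c) \<omega> = (0 :: real)"
        using False by (meson indicator_simps(2))
      then show ?thesis using False by (simp only: mult_zero_left if_False)
    qed
    moreover have "?c \<in> \<C>" using Cs_in_\<D>[OF \<omega>] by (simp add: \<C>_def)
    ultimately show ?thesis using fin by (simp cong: sum.cong)
  qed
  show "?f \<in> borel_measurable P"
    using g_meas path_event by (subst measurable_cong[OF f_eq]) auto
  have integrable: "integrable P (g c)" if "c \<in> \<C>" for c
    using bound g_meas[OF that] by (intro integrable_const_bound[of _ C]) auto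
  have "expectation ?f = expectation (\<lambda>\<omega>. \<Sum>c\<in>\<C>. indicator (division_path k c) \<omega> * g c \<omega>)"
    by (intro Bochner_Integration.integral_cong refl f_eq)
  also have "\<dots> = (\<Sum>c\<in>\<C>. expectation (\<lambda>\<omega>. indicator (division_path k c) \<omega> * g c \<omega>))"
    using integrable path_event
    by (intro Bochner_Integration.integral_sum integrable_mult_indicator[where 'b = real, unfolded real_scaleR_def]) auto
  also have "\<dots> = (\<Sum>c\<in>\<C>. prob (division_path k c) * expectation (g c))"
  proof (intro sum.cong refl expectation_indicator_mult[OF indep_divisions _ division_sigma_algebra])
    show "sigma_algebra (space P) (sets data_algebra)"
      using sets.sigma_algebra_axioms[of data_algebra] by simp
    show "g c -` A \<inter> space P \<in> sets data_algebra" if "c \<in> \<C>" "A \<in> sets borel" for c A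
      using measurable_sets[OF g[OF that(1)] that(2)] by simp
  qed (use bound division_path_in in auto)
  also have "\<dots> = (\<Sum>c\<in>\<C>. 1 / real (card \<C>) * expectation (g c))"
    using prob_division_path unfolding \<C>_def by (intro sum.cong refl) simp
  also have "\<dots> = expectation (\<lambda>\<omega>. avg \<C> (\<lambda>c. g c \<omega>))"
    using integrable by (simp add: avg_def sum_divide_distrib)
  finally show "expectation ?f = expectation (\<lambda>\<omega>. avg \<C> (\<lambda>c. g c \<omega>))" .
qed

end

section \<open>Passage to continuous time\<close>

lemma quadratic_approx_continuous:
  assumes "quadratic_approx \<Lambda> f f'"
  shows "continuous_on UNIV f"
proof -
  have "norm (f y - f x) \<le> \<Lambda> * norm (y - x)" for x y
    using assms unfolding quadratic_approx_def by blast
  then have "norm (f y - f x) \<le> max 0 \<Lambda> * norm (y - x)" for x y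
    by (meson max.cobounded2 mult_right_mono norm_ge_zero order_trans)
  then have "(max 0 \<Lambda>)-lipschitz_on UNIV f"
    by (intro lipschitz_onI) (auto simp: dist_norm)
  then show ?thesis by (rule lipschitz_on_continuous_on)
qed

lemma quadratic_approx_measurable:
  fixes f :: "'a::euclidean_space \<Rightarrow> 'b::euclidean_space"
  assumes "quadratic_approx \<Lambda> f f'"
  shows "f \<in> borel_measurable borel"
  by (rule borel_measurable_continuous_onI[OF quadratic_approx_continuous[OF assms]])

text \<open>The condition on the drift is phrased for configurations with measurable coordinates, so
  no sigma-algebra on the space of configurations is required.\<close>

lemma euler_measurable:
  fixes w :: "'w \<Rightarrow> nat \<Rightarrow> 'i \<Rightarrow> 'v::euclidean_space"
  assumes x: "\<And>i. i \<in> I \<Longrightarrow> (\<lambda>\<omega>. x \<omega> i) \<in> borel_measurable G"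
    and w: "\<And>r i. i \<in> I \<Longrightarrow> (\<lambda>\<omega>. w \<omega> r i) \<in> borel_measurable G"
    and F: "\<And>r i e. r < R \<Longrightarrow> i \<in> I \<Longrightarrow> (\<And>j. j \<in> I \<Longrightarrow> (\<lambda>\<omega>. e \<omega> j) \<in> borel_measurable G) \<Longrightarrow>
      (\<lambda>\<omega>. F r i (e \<omega>)) \<in> borel_measurable G"
  shows "r \<le> R \<Longrightarrow> i \<in> I \<Longrightarrow> (\<lambda>\<omega>. euler h (w \<omega>) (x \<omega>) F r i) \<in> borel_measurable G"
proof (induction r arbitrary: i)
  case 0
  then show ?case using x by simp
next
  case (Suc r)
  have "(\<lambda>\<omega>. F r i (euler h (w \<omega>) (x \<omega>) F r)) \<in> borel_measurable G"
    using Suc by (intro F) auto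
  then show ?case
    using Suc w by (simp add: borel_measurable_add borel_measurable_scaleR)
qed

section \<open>Drift regularity and reduction to switched equations\<close>

context interacting_particles
begin

lemma particle_drift_lipschitz:
  assumes J: "J \<subseteq> I" "i \<in> J" "J - {i} \<noteq> {}" and near: "\<And>j. j \<in> I \<Longrightarrow> norm (u j - v j) \<le> \<delta>"
  shows "norm (particle_drift b m K J i u - particle_drift b m K J i v) \<le> (\<Lambda> + 2 * B) * \<delta>"
proof -
  have i: "i \<in> I" and "finite J" using J finite_subset by auto
  then have "particle_drift b m K J i u - particle_drift b m K J i v
      = (b (u i) - b (v i)) + (interaction m K J i u - interaction m K J i v)"
    using J(2) by (simp add: particle_drift_eq)
  also have "norm \<dots> \<le> \<Lambda> * \<delta> + 2 * B * \<delta>"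
  proof (rule norm_triangle_mono)
    have "norm (b (u i) - b (v i)) \<le> \<Lambda> * norm (u i - v i)"
      using b unfolding quadratic_approx_def by blast
    also have "\<dots> \<le> \<Lambda> * \<delta>" using near[OF i] \<Lambda>_nonneg by (rule mult_left_mono)
    finally show "norm (b (u i) - b (v i)) \<le> \<Lambda> * \<delta>" .
    show "norm (interaction m K J i u - interaction m K J i v) \<le> 2 * B * \<delta>"
      using J i near by (intro norm_interaction_diff_le_uniform)
  qed
  finally show ?thesis by (simp add: algebra_simps)
qed

lemma particle_drift_measurable:
  assumes J: "J \<subseteq> I" "i \<in> J" and e: "\<And>j. j \<in> I \<Longrightarrow> (\<lambda>\<omega>. e \<omega> j) \<in> borel_measurable G"
  shows "(\<lambda>\<omega>. particle_drift b m K J i (e \<omega>)) \<in> borel_measurable G"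
proof -
  have i: "i \<in> I" using J by blast
  have "(\<lambda>\<omega>. K i j (e \<omega> i, e \<omega> j)) \<in> borel_measurable G" if "j \<in> J - {i}" for j
  proof (rule measurable_compose[of "\<lambda>\<omega>. (e \<omega> i, e \<omega> j)" G borel])
    show "(\<lambda>\<omega>. (e \<omega> i, e \<omega> j)) \<in> borel_measurable G"
      using e i J that by (intro borel_measurable_Pair) auto
    show "K i j \<in> borel_measurable borel"
      using K[OF i, of j] J that by (intro quadratic_approx_measurable) auto
  qed
  moreover have "(\<lambda>\<omega>. b (e \<omega> i)) \<in> borel_measurable G"
    by (rule measurable_compose[OF e[OF i] quadratic_approx_measurable[OF b]])
  ultimately show ?thesis
    unfolding particle_drift_def
    by (intro borel_measurable_add borel_measurable_scaleR borel_measurable_sum borel_measurable_const)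
qed

end

text \<open>The full system knows no time grid. Its integral from 0 is cut at the grid points to
  obtain the blockwise form with the same drift in every block.\<close>

lemma full_system_switched_equation:
  assumes "interacting_particles N n p A \<Lambda> b b' m K K'"
    and \<tau>: "\<tau> > 0" and kT: "real k * \<tau> \<le> T"
    and cont: "\<And>i. i \<in> {1..N} \<Longrightarrow> continuous_on {0..T} (\<lambda>t. x t i)"
    and u_cont: "\<And>i. i \<in> {1..N} \<Longrightarrow> continuous_on {0..} (\<lambda>t. u t i)"
    and u_0: "\<And>i. i \<in> {1..N} \<Longrightarrow> u 0 i = 0"
    and eq: "\<And>i t. i \<in> {1..N} \<Longrightarrow> t \<in> {0..T} \<Longrightarrow>
      x t i = x\<^sub>0 i + integral {0..t} (\<lambda>s. particle_drift b m K {1..N} i (x s)) + u t i"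
  shows "switched_equation {1..N} k \<tau> (\<Lambda> + 2 * (A * \<Lambda>)) (\<lambda>_. particle_drift b m K {1..N}) x u x\<^sub>0"
proof -
  interpret interacting_particles N n p A \<Lambda> b b' m K K' by fact
  show ?thesis
  proof
    show "finite I" "I \<noteq> {}" using I_ne by simp_all
    show "\<tau> > 0" by fact
    show \<Gamma>: "\<Lambda> + 2 * B \<ge> 0" using \<Lambda>_nonneg B_nonneg by simp
    show lipschitz: "norm (particle_drift b m K I i u - particle_drift b m K I i v) \<le> (\<Lambda> + 2 * B) * \<delta>"
      if "i \<in> I" "\<And>j. j \<in> I \<Longrightarrow> norm (u j - v j) \<le> \<delta>" for i u v \<delta>
      using that I_minus_ne by (intro particle_drift_lipschitz) auto
    show "continuous_on {0..real k * \<tau>} (\<lambda>t. x t i)" if "i \<in> I" for i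
      using kT by (intro continuous_on_subset[OF cont[OF that]]) auto
    show "continuous_on {0..real k * \<tau>} (\<lambda>t. u t i)" if "i \<in> I" for i
      by (intro continuous_on_subset[OF u_cont[OF that]]) auto
    have "0 \<le> real k * \<tau>" using \<tau> by simp
    then show "x 0 i = x\<^sub>0 i" if "i \<in> I" for i
      using eq[OF that, of 0] u_0[OF that] kT by simp
    fix l i t assume l: "l < k" and i: "i \<in> I" and t: "real l * \<tau> \<le> t" "t < real (Suc l) * \<tau>"
    have "real (Suc l) * \<tau> \<le> real k * \<tau>" using l \<tau> by (intro mult_right_mono) auto
    then have tT: "t \<le> T" using t kT by linarith
    have l0: "0 \<le> real l * \<tau>" using \<tau> by simp
    let ?g = "\<lambda>s. particle_drift b m K I i (x s)"
    have "continuous_on {0..T} ?g"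
      using I_ne(2) \<Gamma> compact_Icc cont lipschitz[OF i] by (rule continuous_on_lipschitz_family)
    then have "?g integrable_on {0..t}"
      using tT by (intro integrable_continuous_real) (auto intro: continuous_on_subset)
    then have combine: "integral {0..t} ?g = integral {0..real l * \<tau>} ?g + integral {real l * \<tau>..t} ?g"
      using l0 t by (intro Henstock_Kurzweil_Integration.integral_combine[symmetric])
    have 1: "x t i = x\<^sub>0 i + integral {0..t} ?g + u t i"
      using l0 t tT by (intro eq i) auto
    have 2: "x (real l * \<tau>) i = x\<^sub>0 i + integral {0..real l * \<tau>} ?g + u (real l * \<tau>) i"
      using l0 t tT by (intro eq i) auto
    show "x t i = x (real l * \<tau>) i + integral {real l * \<tau>..t} ?g + (u t i - u (real l * \<tau>) i)"
      by (subst 1, subst 2, subst combine) simp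
  qed
qed

lemma rbm_switched_equation:
  assumes "interacting_particles N n p A \<Lambda> b b' m K K'"
    and \<tau>: "\<tau> > 0" and kT: "real k * \<tau> \<le> T"
    and cont: "\<And>i. i \<in> {1..N} \<Longrightarrow> continuous_on {0..T} (\<lambda>t. x t i)"
    and u_cont: "\<And>i. i \<in> {1..N} \<Longrightarrow> continuous_on {0..} (\<lambda>t. u t i)"
    and x_0: "\<And>i. i \<in> {1..N} \<Longrightarrow> x 0 i = x\<^sub>0 i"
    and c: "\<And>l. c l \<in> batch_divisions n p"
    and eq: "\<And>l D i t. D \<in> c l \<Longrightarrow> i \<in> D \<Longrightarrow> t \<in> {real l * \<tau>..<real (Suc l) * \<tau>} \<inter> {0..T} \<Longrightarrow>
      x t i = x (real l * \<tau>) i + integral {real l * \<tau>..t} (\<lambda>s. particle_drift b m K D i (x s))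
        + (u t i - u (real l * \<tau>) i)"
  shows "switched_equation {1..N} k \<tau> (\<Lambda> + 2 * (A * \<Lambda>))
    (\<lambda>l i. particle_drift b m K (batch_of (c l) i) i) x u x\<^sub>0"
proof -
  interpret interacting_particles N n p A \<Lambda> b b' m K K' by fact
  show ?thesis
  proof
    show "finite I" "I \<noteq> {}" using I_ne by simp_all
    show "\<tau> > 0" by fact
    show "\<Lambda> + 2 * B \<ge> 0" using \<Lambda>_nonneg B_nonneg by simp
    show "norm (particle_drift b m K (batch_of (c l) i) i u - particle_drift b m K (batch_of (c l) i) i v)
        \<le> (\<Lambda> + 2 * B) * \<delta>"
      if "i \<in> I" "\<And>j. j \<in> I \<Longrightarrow> norm (u j - v j) \<le> \<delta>" for l i u v \<delta>
      using batch_of_division[OF c that(1)] that(2) by (intro particle_drift_lipschitz)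
    show "continuous_on {0..real k * \<tau>} (\<lambda>t. x t i)" if "i \<in> I" for i
      using kT by (intro continuous_on_subset[OF cont[OF that]]) auto
    show "continuous_on {0..real k * \<tau>} (\<lambda>t. u t i)" if "i \<in> I" for i
      by (intro continuous_on_subset[OF u_cont[OF that]]) auto
    show "x 0 i = x\<^sub>0 i" if "i \<in> I" for i by (rule x_0[OF that])
    fix l i t assume l: "l < k" and i: "i \<in> I" and t: "real l * \<tau> \<le> t" "t < real (Suc l) * \<tau>"
    have "real (Suc l) * \<tau> \<le> real k * \<tau>" using l \<tau> by (intro mult_right_mono) auto
    moreover have "0 \<le> real l * \<tau>" using \<tau> by simp
    ultimately have "t \<in> {real l * \<tau>..<real (Suc l) * \<tau>} \<inter> {0..T}" using t kT by auto
    moreover have "batch_of (c l) i \<in> c l" "i \<in> batch_of (c l) i"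
      using batch_divisionsD[OF c] i by (auto simp: N)
    ultimately show "x t i = x (real l * \<tau>) i
        + integral {real l * \<tau>..t} (\<lambda>s. particle_drift b m K (batch_of (c l) i) i (x s))
        + (u t i - u (real l * \<tau>) i)"
      by (intro eq)
  qed
qed

lemma (in prob_space) tendsto_expectation_bounded:
  fixes \<phi> :: "'b::t2_space \<Rightarrow> real"
  assumes \<phi>: "continuous_on UNIV \<phi>" and bound: "\<And>z. \<bar>\<phi> z\<bar> \<le> C"
    and meas: "\<And>q. (\<lambda>\<omega>. \<phi> (Z q \<omega>)) \<in> borel_measurable M" "(\<lambda>\<omega>. \<phi> (Z' \<omega>)) \<in> borel_measurable M"
    and lim: "AE \<omega> in M. (\<lambda>q. Z q \<omega>) \<longlonglongrightarrow> Z' \<omega>"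
  shows "(\<lambda>q. expectation (\<lambda>\<omega>. \<phi> (Z q \<omega>))) \<longlonglongrightarrow> expectation (\<lambda>\<omega>. \<phi> (Z' \<omega>))"
proof (rule integral_dominated_convergence[where w = "\<lambda>_. C"])
  show "AE \<omega> in M. (\<lambda>q. \<phi> (Z q \<omega>)) \<longlonglongrightarrow> \<phi> (Z' \<omega>)"
    using lim
  proof eventually_elim
    case (elim \<omega>)
    have "isCont \<phi> (Z' \<omega>)" using \<phi> by (simp add: continuous_on_eq_continuous_at)
    then show ?case using elim by (rule isCont_tendsto_compose)
  qed
  show "AE \<omega> in M. norm (\<phi> (Z q \<omega>)) \<le> C" for q using bound by simp
qed (use meas in auto)

text \<open>For each \<open>q\<close> the bound for the schemes holds at every sample point with the
  same constant, so it survives integration over the data and the limit in \<open>q\<close>.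
  Boundedness of \<phi> provides the dominated convergence.\<close>

lemma rbm_weak_error_avg_le:
  fixes b :: "real ^ 'd \<Rightarrow> real ^ 'd" and \<phi> :: "real ^ 'd \<Rightarrow> real" and P :: "'w measure"
  assumes particles: "interacting_particles N n p A \<Lambda> b b' m K K'"
    and \<tau>: "\<tau> > 0" and k: "k \<ge> 1" and kT: "real k * \<tau> \<le> T"
    and \<phi>: "quadratic_approx \<Lambda> \<phi> \<phi>'" and \<phi>_bound: "\<And>z. \<bar>\<phi> z\<bar> \<le> C"
    and randomness: "rbm_randomness n p P X0 W Cs"
    and full: "solves_full_system T \<sigma> b N m K P X0 W X"
    and rbm: "solves_rbm T \<sigma> b N \<tau> m K P X0 W Cs Xt"
  shows "avg {1..N} (\<lambda>i. \<bar>prob_space.expectation P (\<lambda>\<omega>. \<phi> (Xt i (real k * \<tau>) \<omega>))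
      - prob_space.expectation P (\<lambda>\<omega>. \<phi> (X i (real k * \<tau>) \<omega>))\<bar>)
    \<le> \<Lambda> * (weak_const T (A * \<Lambda>) \<Lambda> + strong_const T (A * \<Lambda>) \<Lambda>) * \<tau>"
proof -
  interpret particles: interacting_particles N n p A \<Lambda> b b' m K K' by (rule particles)
  interpret rbm_data n p P X0 W Cs by unfold_locales (rule randomness)
  let ?I = "{1..N}" and ?\<C> = "{..<k} \<rightarrow>\<^sub>E batch_divisions n p" and ?t = "real k * \<tau>"
  let ?bound = "\<Lambda> * (weak_const T (A * \<Lambda>) \<Lambda> + strong_const T (A * \<Lambda>) \<Lambda>) * \<tau>"
  define u where "u \<omega> t i = \<sigma> *\<^sub>R W i t \<omega>" for \<omega> t i
  define w where "w q \<omega> r i = u \<omega> (real (Suc r) * (\<tau> / real (Suc q))) i - u \<omega> (real r * (\<tau> / real (Suc q))) i"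
    for q \<omega> r i
  define x where "x q \<omega> = euler (\<tau> / real (Suc q)) (w q \<omega>) (\<lambda>i. X0 i \<omega>)
    (\<lambda>_. particle_drift b m K ?I) (k * Suc q)" for q \<omega>
  define y where "y q c \<omega> = euler (\<tau> / real (Suc q)) (w q \<omega>) (\<lambda>i. X0 i \<omega>)
    (\<lambda>r i. particle_drift b m K (batch_of (c (r div Suc q)) i) i) (k * Suc q)" for q c \<omega>
  define c where "c \<omega> = restrict (\<lambda>l. Cs l \<omega>) {..<k}" for \<omega>

  have "continuous_process T P (X i)" "continuous_process T P (Xt i)" if "i \<in> ?I" for i
    using full rbm that unfolding solves_full_system_def solves_rbm_def by blast+
  then have "AE \<omega> in P. \<forall>i\<in>?I. continuous_on {0..T} (\<lambda>t. X i t \<omega>)"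
    "AE \<omega> in P. \<forall>i\<in>?I. continuous_on {0..T} (\<lambda>t. Xt i t \<omega>)"
    unfolding continuous_process_def by (intro AE_finite_allI finite_atLeastAtMost; blast)+
  moreover have "AE \<omega> in P. \<forall>i\<in>?I. continuous_on {0..} (\<lambda>t. W i t \<omega>) \<and> W i 0 \<omega> = 0"
  proof (intro AE_finite_allI finite_atLeastAtMost AE_conjI)
    fix i assume "i \<in> ?I"
    then have "standard_brownian_motion P (W i)"
      using randomness unfolding rbm_randomness_def particles.N by blast
    then show "AE \<omega> in P. continuous_on {0..} (\<lambda>t. W i t \<omega>)" "AE \<omega> in P. W i 0 \<omega> = 0"
      unfolding standard_brownian_motion_def by blast+
  qed
  moreover have "AE \<omega> in P. \<forall>i\<in>?I. \<forall>t\<in>{0..T}. X i t \<omega> = X0 i \<omega>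
      + integral {0..t} (\<lambda>s. particle_drift b m K ?I i (\<lambda>j. X j s \<omega>)) + \<sigma> *\<^sub>R W i t \<omega>"
    using full unfolding solves_full_system_def by blast
  moreover have "AE \<omega> in P. \<forall>i\<in>?I. Xt i 0 \<omega> = X0 i \<omega>"
    using rbm unfolding solves_rbm_def by blast
  moreover have "AE \<omega> in P. \<forall>k. \<forall>D\<in>Cs k \<omega>. \<forall>i\<in>D. \<forall>t\<in>{real k * \<tau>..<real (Suc k) * \<tau>} \<inter> {0..T}.
      Xt i t \<omega> = Xt i (real k * \<tau>) \<omega>
        + integral {real k * \<tau>..t} (\<lambda>s. particle_drift b m K D i (\<lambda>j. Xt j s \<omega>))
        + \<sigma> *\<^sub>R (W i t \<omega> - W i (real k * \<tau>) \<omega>)"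
    using rbm unfolding solves_rbm_def by blast
  ultimately have lim: "AE \<omega> in P. \<forall>i\<in>?I. (\<lambda>q. x q \<omega> i) \<longlonglongrightarrow> X i ?t \<omega> \<and> (\<lambda>q. y q (c \<omega>) \<omega> i) \<longlonglongrightarrow> Xt i ?t \<omega>"
    using AE_space
  proof eventually_elim
    case (elim \<omega>)
    have u_cont: "continuous_on {0..} (\<lambda>t. u \<omega> t i)" if "i \<in> ?I" for i
      using elim(3) that unfolding u_def by (intro continuous_intros) blast
    have "switched_equation ?I k \<tau> (\<Lambda> + 2 * (A * \<Lambda>)) (\<lambda>_. particle_drift b m K ?I)
        (\<lambda>t j. X j t \<omega>) (u \<omega>) (\<lambda>i. X0 i \<omega>)"
      using elim(1,3,4) u_cont
      by (intro full_system_switched_equation[OF particles \<tau> kT]) (auto simp: u_def)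
    then interpret full: switched_equation ?I k \<tau> "\<Lambda> + 2 * (A * \<Lambda>)" "\<lambda>_. particle_drift b m K ?I"
      "\<lambda>t j. X j t \<omega>" "u \<omega>" "\<lambda>i. X0 i \<omega>" .
    have "switched_equation ?I k \<tau> (\<Lambda> + 2 * (A * \<Lambda>))
        (\<lambda>l i. particle_drift b m K (batch_of (Cs l \<omega>) i) i) (\<lambda>t j. Xt j t \<omega>) (u \<omega>) (\<lambda>i. X0 i \<omega>)"
    proof (rule rbm_switched_equation[OF particles \<tau> kT])
      show "Cs l \<omega> \<in> batch_divisions n p" for l by (rule Cs_in_\<D>[OF elim(7)])
      show "Xt i t \<omega> = Xt i (real l * \<tau>) \<omega>
          + integral {real l * \<tau>..t} (\<lambda>s. particle_drift b m K D i (\<lambda>j. Xt j s \<omega>))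
          + (u \<omega> t i - u \<omega> (real l * \<tau>) i)"
        if "D \<in> Cs l \<omega>" "i \<in> D" "t \<in> {real l * \<tau>..<real (Suc l) * \<tau>} \<inter> {0..T}" for l D i t
        using elim(6) that unfolding u_def scaleR_diff_right[symmetric] by blast
    qed (use elim(2,5) u_cont in auto)
    then interpret rbm: switched_equation ?I k \<tau> "\<Lambda> + 2 * (A * \<Lambda>)"
      "\<lambda>l i. particle_drift b m K (batch_of (Cs l \<omega>) i) i" "\<lambda>t j. Xt j t \<omega>" "u \<omega>" "\<lambda>i. X0 i \<omega>" .
    have "full.euler_path (Suc q) (k * Suc q) = x q \<omega>" for q
      unfolding full.euler_path_def x_def w_def ..
    \<comment> \<open>The switched equation refers to all divisions, \<open>y\<close> only to the
      first \<open>k\<close>; up to Euler step \<open>k * Suc q\<close> they agree by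
      causality.\<close>
    moreover have "rbm.euler_path (Suc q) (k * Suc q) = y q (c \<omega>) \<omega>" for q
      unfolding rbm.euler_path_def y_def w_def
    proof (rule euler_cong)
      fix s assume "s < k * Suc q"
      then have "s div Suc q < k" by (rule less_mult_imp_div_less)
      then show "(\<lambda>i. particle_drift b m K (batch_of (Cs (s div Suc q) \<omega>) i) i)
        = (\<lambda>i. particle_drift b m K (batch_of (c \<omega> (s div Suc q)) i) i)"
        by (simp add: c_def)
    qed
    ultimately show ?case
      using full.euler_path_tendsto rbm.euler_path_tendsto by (auto simp only:)
  qed

  have w_meas: "(\<lambda>\<omega>. w q \<omega> r i) \<in> borel_measurable data_algebra" if "i \<in> ?I" for q r i
    unfolding w_def u_def using that \<tau> W_measurable[of i]
    by (intro borel_measurable_diff borel_measurable_scaleR borel_measurable_const) (auto simp: particles.N)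
  have X0_meas: "(\<lambda>\<omega>. X0 i \<omega>) \<in> borel_measurable data_algebra" if "i \<in> ?I" for i
    using X0_measurable that by (simp add: particles.N)
  note \<phi>_meas = measurable_compose[OF _ quadratic_approx_measurable[OF \<phi>]]
  have x_meas: "(\<lambda>\<omega>. \<phi> (x q \<omega> i)) \<in> borel_measurable data_algebra" if "i \<in> ?I" for q i
    unfolding x_def
    by (rule \<phi>_meas, rule euler_measurable[OF X0_meas w_meas _ order_refl that])
      (auto intro!: particles.particle_drift_measurable)
  have y_meas: "(\<lambda>\<omega>. \<phi> (y q c \<omega> i)) \<in> borel_measurable data_algebra" if c: "c \<in> ?\<C>" and i: "i \<in> ?I" for q c i
    unfolding y_def
  proof (rule \<phi>_meas, rule euler_measurable[OF X0_meas w_meas _ order_refl i])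
    fix r j and e :: "'w \<Rightarrow> nat \<Rightarrow> real ^ 'd"
    assume r: "r < k * Suc q" and j: "j \<in> ?I" and e: "\<And>j. j \<in> ?I \<Longrightarrow> (\<lambda>\<omega>. e \<omega> j) \<in> borel_measurable data_algebra"
    have "r div Suc q < k" using r by (rule less_mult_imp_div_less)
    then have "c (r div Suc q) \<in> batch_divisions n p" using c by auto
    then show "(\<lambda>\<omega>. particle_drift b m K (batch_of (c (r div Suc q)) j) j (e \<omega>)) \<in> borel_measurable data_algebra"
      using particles.batch_of_division[OF _ j] e by (intro particles.particle_drift_measurable) auto
  qed

  have step: "avg ?I (\<lambda>i. \<bar>expectation (\<lambda>\<omega>. \<phi> (y q (c \<omega>) \<omega> i)) - expectation (\<lambda>\<omega>. \<phi> (x q \<omega> i))\<bar>) \<le> ?bound" for q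
  proof -
    define f where "f i \<omega> = avg ?\<C> (\<lambda>c. \<phi> (y q c \<omega> i)) - \<phi> (x q \<omega> i)" for i \<omega>
    have int_x: "integrable P (\<lambda>\<omega>. \<phi> (x q \<omega> i))" if "i \<in> ?I" for i
      using data_algebra_measurable[OF x_meas[OF that]] \<phi>_bound
      by (intro integrable_const_bound[of _ C]) auto
    have "integrable P (\<lambda>\<omega>. \<phi> (y q c \<omega> i))" if "c \<in> ?\<C>" "i \<in> ?I" for c i
      using data_algebra_measurable[OF y_meas[OF that]] \<phi>_bound
      by (intro integrable_const_bound[of _ C]) auto
    then have int_y: "integrable P (\<lambda>\<omega>. avg ?\<C> (\<lambda>c. \<phi> (y q c \<omega> i)))" if "i \<in> ?I" for i
      using that unfolding avg_def by (intro integrable_scaleR_right Bochner_Integration.integrable_sum) auto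
    have int_f: "integrable P (f i)" if "i \<in> ?I" for i
      unfolding f_def using int_y[OF that] int_x[OF that] by (rule Bochner_Integration.integrable_diff)
    have "expectation (\<lambda>\<omega>. \<phi> (y q (c \<omega>) \<omega> i)) - expectation (\<lambda>\<omega>. \<phi> (x q \<omega> i)) = expectation (f i)"
      if "i \<in> ?I" for i
    proof -
      \<comment> \<open>Here the random divisions give way to the uniform average: for fixed
        \<open>c\<close> the scheme is measurable with respect to \<open>data_algebra\<close>, hence
        independent of the divisions.\<close>
      have "expectation (\<lambda>\<omega>. \<phi> (y q (c \<omega>) \<omega> i)) = expectation (\<lambda>\<omega>. avg ?\<C> (\<lambda>c. \<phi> (y q c \<omega> i)))"
        unfolding c_def
        by (rule resample_divisions(2)[where g = "\<lambda>c \<omega>. \<phi> (y q c \<omega> i)", OF y_meas[OF _ that] \<phi>_bound])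
      then show ?thesis
        unfolding f_def using int_x[OF that] int_y[OF that] by (simp add: Bochner_Integration.integral_diff)
    qed
    then have "avg ?I (\<lambda>i. \<bar>expectation (\<lambda>\<omega>. \<phi> (y q (c \<omega>) \<omega> i)) - expectation (\<lambda>\<omega>. \<phi> (x q \<omega> i))\<bar>)
        = avg ?I (\<lambda>i. \<bar>expectation (f i)\<bar>)"
      by (intro avg_cong refl) simp
    also have "\<dots> \<le> avg ?I (\<lambda>i. expectation (\<lambda>\<omega>. \<bar>f i \<omega>\<bar>))"
      by (intro avg_mono integral_abs_bound)
    also have "\<dots> = expectation (\<lambda>\<omega>. avg ?I (\<lambda>i. \<bar>f i \<omega>\<bar>))"
      unfolding avg_def using int_f by (simp add: Bochner_Integration.integral_sum)
    also have "\<dots> \<le> ?bound"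
    proof (rule integral_le_const)
      show "integrable P (\<lambda>\<omega>. avg ?I (\<lambda>i. \<bar>f i \<omega>\<bar>))"
        unfolding avg_def using int_f by (intro integrable_scaleR_right Bochner_Integration.integrable_sum integrable_abs) auto
      have "avg ?I (\<lambda>i. \<bar>f i \<omega>\<bar>) \<le> ?bound" for \<omega>
      proof -
        \<comment> \<open>The noise increments and initial values at the single point \<omega>
          become the fixed parameters of the two schemes.\<close>
        interpret pair: euler_pair N n p A \<Lambda> b b' m K K' T \<tau> "\<tau> / real (Suc q)" k "Suc q" "w q \<omega>" "\<lambda>i. X0 i \<omega>"
          by unfold_locales (use \<tau> k kT in auto)
        have "pair.x (k * Suc q) = x q \<omega>" "pair.y c (k * Suc q) = y q c \<omega>" for c
          by (simp_all only: pair.x_def pair.y_def x_def y_def)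
        then show ?thesis
          using pair.discrete_weak_error_le[OF \<phi>] unfolding f_def by (simp only:)
      qed
      then show "AE \<omega> in P. avg ?I (\<lambda>i. \<bar>f i \<omega>\<bar>) \<le> ?bound" by simp
    qed
    finally show ?thesis .
  qed

  have yc_meas: "(\<lambda>\<omega>. \<phi> (y q (c \<omega>) \<omega> i)) \<in> borel_measurable P" if "i \<in> ?I" for q i
    unfolding c_def
    by (rule resample_divisions(1)[where g = "\<lambda>c \<omega>. \<phi> (y q c \<omega> i)", OF y_meas[OF _ that] \<phi>_bound])
  have T: "?t \<in> {0..T}" using \<tau> kT by simp
  have X_meas: "(\<lambda>\<omega>. \<phi> (X i ?t \<omega>)) \<in> borel_measurable P" "(\<lambda>\<omega>. \<phi> (Xt i ?t \<omega>)) \<in> borel_measurable P"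
    if "i \<in> ?I" for i
    using full rbm T that unfolding solves_full_system_def solves_rbm_def continuous_process_def
    by (auto intro!: \<phi>_meas)
  have "(\<lambda>q. expectation (\<lambda>\<omega>. \<phi> (x q \<omega> i))) \<longlonglongrightarrow> expectation (\<lambda>\<omega>. \<phi> (X i ?t \<omega>))" if "i \<in> ?I" for i
    using X_meas[OF that] lim that data_algebra_measurable[OF x_meas[OF that]]
    by (intro tendsto_expectation_bounded[OF quadratic_approx_continuous[OF \<phi>] \<phi>_bound]) auto
  moreover have "(\<lambda>q. expectation (\<lambda>\<omega>. \<phi> (y q (c \<omega>) \<omega> i))) \<longlonglongrightarrow> expectation (\<lambda>\<omega>. \<phi> (Xt i ?t \<omega>))" if "i \<in> ?I" for i
    using X_meas[OF that] lim that yc_meas[OF that]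
    by (intro tendsto_expectation_bounded[OF quadratic_approx_continuous[OF \<phi>] \<phi>_bound]) auto
  ultimately have "(\<lambda>q. avg ?I (\<lambda>i. \<bar>expectation (\<lambda>\<omega>. \<phi> (y q (c \<omega>) \<omega> i)) - expectation (\<lambda>\<omega>. \<phi> (x q \<omega> i))\<bar>))
      \<longlonglongrightarrow> avg ?I (\<lambda>i. \<bar>expectation (\<lambda>\<omega>. \<phi> (Xt i ?t \<omega>)) - expectation (\<lambda>\<omega>. \<phi> (X i ?t \<omega>))\<bar>)"
    unfolding avg_def by (intro tendsto_intros) auto
  then show ?thesis
    using step by (intro LIMSEQ_le_const2) auto
qed

section \<open>The weak error\<close>

lemma derivs_bounded_by_mono:
  "derivs_bounded_by S l f \<Longrightarrow> S' \<subseteq> S \<Longrightarrow> l \<le> l' \<Longrightarrow> derivs_bounded_by S' l' f"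
  unfolding derivs_bounded_by_def by (meson order_trans subsetD)

text \<open>There are finitely many lists of basis vectors of length at most \<open>k\<close>, so
  the sum of the individual bounds is a common one.\<close>

lemma Cb_inf_derivs_bounded:
  fixes \<phi> :: "'a::euclidean_space \<Rightarrow> real"
  assumes "\<phi> \<in> Cb_inf"
  obtains l where "l \<ge> 0" "derivs_bounded_by {0..k} l \<phi>"
proof -
  let ?V = "{vs :: 'a list. set vs \<subseteq> Basis \<and> length vs \<le> k}"
  have "\<forall>vs\<in>?V. \<exists>l. \<forall>x. norm (partials vs \<phi> x) \<le> l"
    using assms unfolding Cb_inf_def bounded_iff by auto
  then obtain l where l: "\<And>vs x. vs \<in> ?V \<Longrightarrow> norm (partials vs \<phi> x) \<le> l vs" by metis
  have fin: "finite ?V" by (intro finite_lists_length_le finite_Basis)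
  have ge: "0 \<le> l vs" if "vs \<in> ?V" for vs
    using l[OF that] norm_ge_zero order_trans by blast
  have "norm (partials vs \<phi> x) \<le> sum l ?V" if "vs \<in> ?V" for vs x
    using l[OF that] member_le_sum[OF that _ fin, of l] ge by (meson Diff_iff order_trans)
  then have "derivs_bounded_by {0..k} (sum l ?V) \<phi>"
    unfolding derivs_bounded_by_def by auto
  moreover have "0 \<le> sum l ?V" using ge by (rule sum_nonneg)
  ultimately show ?thesis using that by blast
qed

lemma abs_weighted_sum_diff_le:
  fixes f g :: "nat \<Rightarrow> real"
  assumes "\<And>i. i \<in> {1..N} \<Longrightarrow> 0 \<le> v i \<and> v i \<le> a"
  shows "\<bar>1 / real N * (\<Sum>i\<in>{1..N}. v i * f i) - 1 / real N * (\<Sum>i\<in>{1..N}. v i * g i)\<bar>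
    \<le> a * avg {1..N} (\<lambda>i. \<bar>f i - g i\<bar>)"
proof -
  have "1 / real N * (\<Sum>i\<in>{1..N}. v i * f i) - 1 / real N * (\<Sum>i\<in>{1..N}. v i * g i)
      = avg {1..N} (\<lambda>i. v i * f i) - avg {1..N} (\<lambda>i. v i * g i)"
    by (simp add: avg_def)
  also have "\<dots> = avg {1..N} (\<lambda>i. v i * (f i - g i))"
    by (simp only: avg_diff right_diff_distrib)
  also have "norm \<dots> \<le> avg {1..N} (\<lambda>i. a * \<bar>f i - g i\<bar>)"
    using assms by (intro order_trans[OF norm_avg_le] avg_mono) (auto simp: abs_mult intro: mult_right_mono)
  finally show ?thesis by (simp only: avg_mult real_norm_def)
qed

text \<open>Nonnegative weights pass unchanged through \<open>ennreal\<close>, and the integral over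
  the image measure is then one over a finite point measure.\<close>

lemma integral_empirical_measure:
  fixes \<phi> :: "real ^ 'd \<Rightarrow> real"
  assumes \<phi>: "\<phi> \<in> borel_measurable borel" and v: "\<And>j. j \<in> {1..N} \<Longrightarrow> 0 \<le> particle_weight N m j"
  shows "(\<integral>x. \<phi> x \<partial>empirical_measure N m z) = 1 / real N * (\<Sum>j\<in>{1..N}. particle_weight N m j * \<phi> (z j))"
proof -
  have "(\<integral>x. \<phi> x \<partial>empirical_measure N m z)
      = (\<integral>j. \<phi> (z j) \<partial>point_measure {1..N} (\<lambda>j. ennreal (particle_weight N m j / real N)))"
    unfolding empirical_measure_def
    using \<phi> by (intro integral_distr) (simp_all add: measurable_def sets_point_measure space_point_measure)
  also have "\<dots> = (\<Sum>j\<in>{1..N}. (particle_weight N m j / real N) *\<^sub>R \<phi> (z j))"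
    using v by (intro lebesgue_integral_point_measure_finite) auto
  finally show ?thesis by (simp add: sum_distrib_left)
qed

lemma empirical_weak_error_eq:
  fixes \<phi> :: "real ^ 'd \<Rightarrow> real"
  assumes "prob_space P" and \<phi>: "\<phi> \<in> borel_measurable borel" and bound: "\<And>z. \<bar>\<phi> z\<bar> \<le> C"
    and v: "\<And>j. j \<in> {1..N} \<Longrightarrow> 0 \<le> particle_weight N m j"
    and X: "\<And>i. i \<in> {1..N} \<Longrightarrow> X i (real k * \<tau>) \<in> borel_measurable P"
    and Y: "\<And>i. i \<in> {1..N} \<Longrightarrow> Y i (real k * \<tau>) \<in> borel_measurable P"
  shows "empirical_weak_error P N \<tau> m \<phi> X Y k = weak_error P N \<tau> m \<phi> X Y k"
proof -
  interpret prob_space P by fact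
  have "expectation (\<lambda>\<omega>. \<integral>x. \<phi> x \<partial>empirical_measure N m (\<lambda>j. Z j (real k * \<tau>) \<omega>))
      = 1 / real N * (\<Sum>i\<in>{1..N}. particle_weight N m i * expectation (\<lambda>\<omega>. \<phi> (Z i (real k * \<tau>) \<omega>)))"
    if "\<And>i. i \<in> {1..N} \<Longrightarrow> Z i (real k * \<tau>) \<in> borel_measurable P" for Z
  proof -
    have "integrable P (\<lambda>\<omega>. \<phi> (Z i (real k * \<tau>) \<omega>))" if "i \<in> {1..N}" for i
      using bound measurable_compose[OF \<open>\<And>i. i \<in> {1..N} \<Longrightarrow> Z i (real k * \<tau>) \<in> borel_measurable P\<close>[OF that] \<phi>]
      by (intro integrable_const_bound[of _ C]) auto
    moreover have "expectation (\<lambda>\<omega>. \<integral>x. \<phi> x \<partial>empirical_measure N m (\<lambda>j. Z j (real k * \<tau>) \<omega>))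
        = expectation (\<lambda>\<omega>. 1 / real N * (\<Sum>i\<in>{1..N}. particle_weight N m i * \<phi> (Z i (real k * \<tau>) \<omega>)))"
      by (intro Bochner_Integration.integral_cong refl integral_empirical_measure \<phi> v)
    ultimately show ?thesis by (simp add: Bochner_Integration.integral_sum)
  qed
  then show ?thesis using X Y unfolding empirical_weak_error_def weak_error_def by simp
qed

text \<open>Covers \<open>k = 0\<close>, which the pair of schemes excludes. Both processes start at
  \<open>X0\<close> only almost surely, the full one because \<open>W i 0\<close> vanishes almost
  surely.\<close>

lemma expectation_initial_eq:
  fixes \<phi> :: "real ^ 'd \<Rightarrow> real"
  assumes R: "rbm_randomness n p P X0 W Cs" and N: "N = n * p" and T: "T \<ge> 0"
    and full: "solves_full_system T \<sigma> b N m K P X0 W X"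
    and rbm: "solves_rbm T \<sigma> b N \<tau> m K P X0 W Cs Xt"
    and \<phi>: "\<phi> \<in> borel_measurable borel" and i: "i \<in> {1..N}"
  shows "prob_space.expectation P (\<lambda>\<omega>. \<phi> (Xt i 0 \<omega>)) = prob_space.expectation P (\<lambda>\<omega>. \<phi> (X i 0 \<omega>))"
proof (rule integral_cong_AE)
  have "standard_brownian_motion P (W i)"
    using R i unfolding rbm_randomness_def N by blast
  then have "AE \<omega> in P. W i 0 \<omega> = 0"
    unfolding standard_brownian_motion_def by blast
  moreover have "AE \<omega> in P. \<forall>i\<in>{1..N}. \<forall>t\<in>{0..T}. X i t \<omega> = X0 i \<omega>
      + integral {0..t} (\<lambda>s. particle_drift b m K {1..N} i (\<lambda>j. X j s \<omega>)) + \<sigma> *\<^sub>R W i t \<omega>"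
    using full unfolding solves_full_system_def by blast
  moreover have "AE \<omega> in P. \<forall>i\<in>{1..N}. Xt i 0 \<omega> = X0 i \<omega>"
    using rbm unfolding solves_rbm_def by blast
  ultimately show "AE \<omega> in P. \<phi> (Xt i 0 \<omega>) = \<phi> (X i 0 \<omega>)"
  proof eventually_elim
    case (elim \<omega>)
    have "X i 0 \<omega> = X0 i \<omega>
        + integral {0..0} (\<lambda>s. particle_drift b m K {1..N} i (\<lambda>j. X j s \<omega>)) + \<sigma> *\<^sub>R W i 0 \<omega>"
      using elim(2) i T by simp
    then show ?case using elim(1,3) i by simp
  qed
  have "continuous_process T P (X i)" "continuous_process T P (Xt i)"
    using full rbm i unfolding solves_full_system_def solves_rbm_def by blast+
  then have meas: "X i 0 \<in> borel_measurable P" "Xt i 0 \<in> borel_measurable P"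
    using T unfolding continuous_process_def by auto
  show "(\<lambda>\<omega>. \<phi> (X i 0 \<omega>)) \<in> borel_measurable P" "(\<lambda>\<omega>. \<phi> (Xt i 0 \<omega>)) \<in> borel_measurable P"
    by (rule measurable_compose[OF meas(1) \<phi>], rule measurable_compose[OF meas(2) \<phi>])
qed

theorem theorem4p1:
  fixes T \<sigma> A M L :: real
    and b :: "real ^ 'd \<Rightarrow> real ^ 'd"
    and \<phi> :: "real ^ 'd \<Rightarrow> real"
  assumes "T > 0" and "A > 0" and "M > 0"
    and "Ck 4 b" and "derivs_bounded_by {1..4} L b"
    and "\<phi> \<in> Cb_inf"
  shows "\<exists>C. \<forall>(N::nat) (n::nat) (p::nat) (\<tau>::real) (m :: nat \<Rightarrow> real)
      (K :: nat \<Rightarrow> nat \<Rightarrow> (real ^ 'd) \<times> (real ^ 'd) \<Rightarrow> real ^ 'd)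
      (P :: 'w measure) (X0 :: nat \<Rightarrow> 'w \<Rightarrow> real ^ 'd)
      (W :: nat \<Rightarrow> real \<Rightarrow> 'w \<Rightarrow> real ^ 'd) (Cs :: nat \<Rightarrow> 'w \<Rightarrow> nat set set)
      (X :: nat \<Rightarrow> real \<Rightarrow> 'w \<Rightarrow> real ^ 'd) (Xt :: nat \<Rightarrow> real \<Rightarrow> 'w \<Rightarrow> real ^ 'd).
      N = n * p \<and> n \<ge> 1 \<and> p \<ge> 2 \<and> \<tau> > 0 \<and>
      (\<forall>j\<in>{1..N}. m j \<ge> 0) \<and>
      1 / real N * (\<Sum>j\<in>{1..N}. m j) = M \<and>
      (MAX j\<in>{1..N}. \<bar>m j\<bar>) \<le> A \<and>
      (\<forall>i\<in>{1..N}. \<forall>j\<in>{1..N}. Ck 4 (K i j) \<and> derivs_bounded_by {0..4} L (K i j)) \<and>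
      rbm_randomness n p P X0 W Cs \<and>
      solves_full_system T \<sigma> b N m K P X0 W X \<and>
      solves_rbm T \<sigma> b N \<tau> m K P X0 W Cs Xt
      \<longrightarrow>
      (SUP k\<in>{k. real k * \<tau> \<le> T}. empirical_weak_error P N \<tau> m \<phi> X Xt k) \<le> C * \<tau> \<and>
      (SUP k\<in>{k. real k * \<tau> \<le> T}. weak_error P N \<tau> m \<phi> X Xt k) \<le> C * \<tau>"
proof -
  obtain l where l: "l \<ge> 0" "derivs_bounded_by {0..2} l \<phi>"
    using Cb_inf_derivs_bounded[OF assms(6)] by blast
  define L' where "L' = max \<bar>L\<bar> l"
  \<comment> \<open>The kernels live on pairs, of dimension \<open>2 * CARD('d)\<close>; their
    factor dominates those for \<open>b\<close> and \<phi> and also \<open>L'\<close> itself, so one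
    constant serves all.\<close>
  define \<Lambda> where "\<Lambda> = (2 * real CARD('d))\<^sup>2 * L'"
  have L': "L \<le> L'" "l \<le> L'" "0 \<le> L'" by (auto simp: L'_def)
  have d: "1 \<le> (real CARD('d))\<^sup>2" by (intro one_le_power) (simp add: Suc_leI)
  have \<Lambda>_eq: "\<Lambda> = 4 * (real CARD('d))\<^sup>2 * L'" by (simp add: \<Lambda>_def power_mult_distrib)
  have "1 * L' \<le> \<Lambda>" unfolding \<Lambda>_eq using d by (intro mult_right_mono L'(3)) linarith
  moreover have "(real CARD('d))\<^sup>2 * L' \<le> \<Lambda>"
    unfolding \<Lambda>_eq using d by (intro mult_right_mono L'(3)) linarith
  ultimately have \<Lambda>: "L' \<le> \<Lambda>" "(real CARD('d))\<^sup>2 * L' \<le> \<Lambda>" "0 \<le> \<Lambda>" using L'(3) by auto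
  have "quadratic_approx ((real CARD('d))\<^sup>2 * L') b (\<lambda>x. frechet_derivative b (at x))"
    using quadratic_approx_frechet[OF assms(4) derivs_bounded_by_mono[OF assms(5) order_refl L'(1)]] by simp
  then have b: "quadratic_approx \<Lambda> b (\<lambda>x. frechet_derivative b (at x))"
    using \<Lambda>(2) by (rule quadratic_approx_mono)
  have "Ck 2 \<phi>" using assms(6) unfolding Cb_inf_def by blast
  then have "quadratic_approx ((real CARD('d))\<^sup>2 * L') \<phi> (\<lambda>x. frechet_derivative \<phi> (at x))"
    using quadratic_approx_frechet[OF _ derivs_bounded_by_mono[OF l(2) order_refl L'(2)]] by simp
  then have \<phi>: "quadratic_approx \<Lambda> \<phi> (\<lambda>x. frechet_derivative \<phi> (at x))"
    using \<Lambda>(2) by (rule quadratic_approx_mono)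
  have \<phi>_bound: "\<bar>\<phi> z\<bar> \<le> l" for z
    using l(2) unfolding derivs_bounded_by_def by (auto dest!: spec[of _ "[]"])
  \<comment> \<open>\<open>A / M\<close> bounds the weights, and \<open>max 0\<close> makes the
    constant nonnegative without inspecting signs. It is fixed before \<open>N\<close>, \<tau>, the
    kernels and the probability space are introduced.\<close>
  define C where "C = A / M * max 0 (\<Lambda> * (weak_const T (A * \<Lambda>) \<Lambda> + strong_const T (A * \<Lambda>) \<Lambda>))"
  have C: "C \<ge> 0" using assms(2,3) by (simp add: C_def)
  show ?thesis
  proof (intro exI[of _ C] allI impI, elim conjE)
    fix N n p \<tau> m and K :: "nat \<Rightarrow> nat \<Rightarrow> (real ^ 'd) \<times> (real ^ 'd) \<Rightarrow> real ^ 'd"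
      and P :: "'w measure" and X0 W Cs X Xt
    assume N: "N = n * p" "n \<ge> 1" "p \<ge> 2" and \<tau>: "\<tau> > 0" and m_nonneg: "\<forall>j\<in>{1..N}. m j \<ge> 0"
      and mean: "1 / real N * (\<Sum>j\<in>{1..N}. m j) = M" and m_max: "(MAX j\<in>{1..N}. \<bar>m j\<bar>) \<le> A"
      and K: "\<forall>i\<in>{1..N}. \<forall>j\<in>{1..N}. Ck 4 (K i j) \<and> derivs_bounded_by {0..4} L (K i j)"
      and R: "rbm_randomness n p P X0 W Cs"
      and full: "solves_full_system T \<sigma> b N m K P X0 W X"
      and rbm: "solves_rbm T \<sigma> b N \<tau> m K P X0 W Cs Xt"
    interpret rbm_data n p P X0 W Cs by unfold_locales (rule R)
    have m: "0 \<le> m j \<and> m j \<le> A" if "j \<in> {1..N}" for j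
    proof -
      have "\<bar>m j\<bar> \<le> (MAX j\<in>{1..N}. \<bar>m j\<bar>)" using that by (intro Max_ge) auto
      then show ?thesis using m_nonneg m_max that by force
    qed
    have particles: "interacting_particles N n p A \<Lambda> b (\<lambda>x. frechet_derivative b (at x)) m K
      (\<lambda>i j x. frechet_derivative (K i j) (at x))"
    proof
      show "batch_divisions n p \<noteq> {}" by (rule \<D>_nonempty)
      fix i j assume ij: "i \<in> {1..N}" "j \<in> {1..N}"
      then have Kij: "Ck 4 (K i j)" "derivs_bounded_by {0..4} L' (K i j)"
        using K derivs_bounded_by_mono[OF _ order_refl L'(1)] by blast+
      show "quadratic_approx \<Lambda> (K i j) (\<lambda>x. frechet_derivative (K i j) (at x))"
        using quadratic_approx_frechet[OF Kij] by (simp add: \<Lambda>_def)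
      have "norm (K i j z) \<le> L'" for z
        using Kij(2) unfolding derivs_bounded_by_def by (cases z) (auto dest!: spec[of _ "[]"])
      then show "norm (K i j z) \<le> \<Lambda>" for z using \<Lambda>(1) order_trans by blast
    qed (use N \<Lambda> b m in auto)
    have "N \<ge> 1" using N by (metis mult_le_mono nat_mult_1 one_le_numeral order_trans)
    \<comment> \<open>Hence \<open>particle_weight N m j\<close> equals \<open>m j / M\<close>,
      which is at most \<open>A / M\<close>.\<close>
    then have total: "(\<Sum>j\<in>{1..N}. m j) = real N * M" using mean by (simp add: field_simps)
    have weight: "0 \<le> particle_weight N m j \<and> particle_weight N m j \<le> A / M" if "j \<in> {1..N}" for j
      using m[OF that] \<open>N \<ge> 1\<close> assms(3) unfolding particle_weight_def total by (simp add: divide_right_mono)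
    note \<phi>_meas = quadratic_approx_measurable[OF \<phi>]
    have error: "weak_error P N \<tau> m \<phi> X Xt k \<le> C * \<tau>" if kT: "real k * \<tau> \<le> T" for k
    proof -
      let ?e = "avg {1..N} (\<lambda>i. \<bar>expectation (\<lambda>\<omega>. \<phi> (Xt i (real k * \<tau>) \<omega>))
        - expectation (\<lambda>\<omega>. \<phi> (X i (real k * \<tau>) \<omega>))\<bar>)"
      have "?e \<le> max 0 (\<Lambda> * (weak_const T (A * \<Lambda>) \<Lambda> + strong_const T (A * \<Lambda>) \<Lambda>)) * \<tau>"
      proof (cases "k = 0")
        case True
        then have "?e = avg {1..N} (\<lambda>i. 0)"
          using expectation_initial_eq[OF R N(1) _ full rbm \<phi>_meas] assms(1) by (intro avg_cong) auto
        also have "\<dots> = 0" by (simp add: avg_def)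
        finally have "?e = 0" .
        then show ?thesis using \<tau> by (simp only: mult_nonneg_nonneg max.cobounded1 less_imp_le)
      next
        case False
        then have "?e \<le> \<Lambda> * (weak_const T (A * \<Lambda>) \<Lambda> + strong_const T (A * \<Lambda>) \<Lambda>) * \<tau>"
          by (intro rbm_weak_error_avg_le[OF particles \<tau> _ kT \<phi> \<phi>_bound R full rbm]) simp
        also have "\<dots> \<le> max 0 (\<Lambda> * (weak_const T (A * \<Lambda>) \<Lambda> + strong_const T (A * \<Lambda>) \<Lambda>)) * \<tau>"
          using \<tau> by (intro mult_right_mono) auto
        finally show ?thesis .
      qed
      then have "A / M * ?e \<le> C * \<tau>"
        unfolding C_def mult.assoc[of "A / M"] using assms(2,3) by (intro mult_left_mono) auto
      moreover have "weak_error P N \<tau> m \<phi> X Xt k \<le> A / M * ?e"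
        unfolding weak_error_def by (rule abs_weighted_sum_diff_le[OF weight])
      ultimately show ?thesis by (rule order_trans[rotated])
    qed
    have empirical: "empirical_weak_error P N \<tau> m \<phi> X Xt k = weak_error P N \<tau> m \<phi> X Xt k"
      if kT: "real k * \<tau> \<le> T" for k
    proof (rule empirical_weak_error_eq[OF prob_space_axioms \<phi>_meas \<phi>_bound])
      fix i assume i: "i \<in> {1..N}"
      show "0 \<le> particle_weight N m i" using weight[OF i] by simp
      have "continuous_process T P (X i)" "continuous_process T P (Xt i)"
        using full rbm i unfolding solves_full_system_def solves_rbm_def by blast+
      moreover have "real k * \<tau> \<in> {0..T}" using kT \<tau> by simp
      ultimately show "X i (real k * \<tau>) \<in> borel_measurable P" "Xt i (real k * \<tau>) \<in> borel_measurable P"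
        unfolding continuous_process_def by blast+
    qed
    have "0 \<in> {k. real k * \<tau> \<le> T}" using assms(1) by simp
    then have ne: "{k. real k * \<tau> \<le> T} \<noteq> {}" by blast
    show "(SUP k\<in>{k. real k * \<tau> \<le> T}. empirical_weak_error P N \<tau> m \<phi> X Xt k) \<le> C * \<tau> \<and>
      (SUP k\<in>{k. real k * \<tau> \<le> T}. weak_error P N \<tau> m \<phi> X Xt k) \<le> C * \<tau>"
      using error empirical by (intro conjI cSUP_least ne) auto
  qed
qed

end
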